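(* Let $(X,\mathscr A,\mu)$ be a $\sigma$-finite measure space and let $\phi$ be a nonsingular transformation of $X$. If $C_\phi$ is densely defined, then $C_\phi$ is quasinormal if and only if $\mathsf h_\phi=\mathsf h_\phi\circ\phi$ a.e. $[\mu]$.
   Context: $L^2(\mu)$ is the complex Hilbert space of square integrable complex functions on $X$. A transformation $\phi\colon X\to X$ is nonsingular if $\phi^{-1}(\Delta)\in\mathscr A$ for all $\Delta\in\mathscr A$ and the measure $\mu\circ\phi^{-1}$, $\Delta\mapsto\mu(\phi^{-1}(\Delta))$, is absolutely continuous with respect to $\mu$. The composition operator $C_\phi$ in $L^2(\mu)$ is given by $\mathcal D(C_\phi)=\{f\in L^2(\mu)\colon f\circ\phi\in L^2(\mu)\}$, $C_\phi f=f\circ\phi$ (possibly unbounded; it is always a closed operator). $\mathsf h_\phi\colon X\to[0,\infty]$ is the ($\mu$-a.e. unique) $\mathscr A$-measurable function with $\mu(\phi^{-1}(\Delta))=\int_\Delta\mathsf h_\phi\,d\mu$ for all $\Delta\in\mathscr A$. A closed densely defined operator $A$ in a complex Hilbert space is quasinormal if it commutes with the spectral measure $E_{|A|}$ of $|A|=(A^*A)^{1/2}$, i.e. $E_{|A|}(\Delta)A\subseteq AE_{|A|}(\Delta)$ for all Borel sets $\Delta\subseteq[0,\infty)$. *)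

theory Defs
  imports "HOL-Analysis.Analysis"
begin

section \<open>Unbounded operators in a complex Hilbert space\<close>

text \<open>
  The Hilbert space \<open>L\<^sup>2(\<mu>)\<close> depends on a term-level measure, so Hilbert spaces are given by an
  explicit carrier with its operations. The inner product is linear in the first argument.
\<close>

record 'v hspace =
  hcarrier :: "'v set"
  hadd :: "'v \<Rightarrow> 'v \<Rightarrow> 'v"
  hscale :: "complex \<Rightarrow> 'v \<Rightarrow> 'v"
  hinner :: "'v \<Rightarrow> 'v \<Rightarrow> complex"

definition hdist :: "('v, 'm) hspace_scheme \<Rightarrow> 'v \<Rightarrow> 'v \<Rightarrow> real" where
  "hdist H x y = (let d = hadd H x (hscale H (-1) y) in sqrt (Re (hinner H d d)))"

text \<open>
  Operators are identified with their graphs: \<open>Domain T\<close> is the domain, and the operator product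
  \<open>S T\<close> (apply \<open>T\<close> first), with its natural domain, is the relation \<open>T O S\<close>. Operator inclusion
  is inclusion of graphs.
\<close>

definition linear_op :: "('v, 'm) hspace_scheme \<Rightarrow> ('v \<times> 'v) set \<Rightarrow> bool" where
  "linear_op H T \<longleftrightarrow>
     T \<subseteq> hcarrier H \<times> hcarrier H \<and> T \<noteq> {} \<and> single_valued T \<and>
     (\<forall>(x, y)\<in>T. \<forall>(x', y')\<in>T. (hadd H x x', hadd H y y') \<in> T) \<and>
     (\<forall>c. \<forall>(x, y)\<in>T. (hscale H c x, hscale H c y) \<in> T)"

definition densely_defined :: "('v, 'm) hspace_scheme \<Rightarrow> ('v \<times> 'v) set \<Rightarrow> bool" where
  "densely_defined H T \<longleftrightarrow> (\<forall>x\<in>hcarrier H. \<forall>e>0. \<exists>y\<in>Domain T. hdist H x y < e)"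

definition closed_op :: "('v, 'm) hspace_scheme \<Rightarrow> ('v \<times> 'v) set \<Rightarrow> bool" where
  "closed_op H T \<longleftrightarrow>
     (\<forall>u v. \<forall>x\<in>hcarrier H. \<forall>y\<in>hcarrier H.
        (\<forall>n::nat. (u n, v n) \<in> T) \<and>
        (\<lambda>n. hdist H (u n) x) \<longlonglongrightarrow> 0 \<and> (\<lambda>n. hdist H (v n) y) \<longlonglongrightarrow> 0 \<longrightarrow> (x, y) \<in> T)"

definition adjoint_op :: "('v, 'm) hspace_scheme \<Rightarrow> ('v \<times> 'v) set \<Rightarrow> ('v \<times> 'v) set" where
  "adjoint_op H T =
     {(y, z). y \<in> hcarrier H \<and> z \<in> hcarrier H \<and> (\<forall>(x, x')\<in>T. hinner H x' y = hinner H x z)}"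

definition positive_selfadjoint :: "('v, 'm) hspace_scheme \<Rightarrow> ('v \<times> 'v) set \<Rightarrow> bool" where
  "positive_selfadjoint H T \<longleftrightarrow>
     linear_op H T \<and> densely_defined H T \<and> adjoint_op H T = T \<and>
     (\<forall>(x, y)\<in>T. hinner H y x \<in> \<real> \<and> 0 \<le> Re (hinner H y x))"

text \<open>\<open>B = |A| = (A\<^sup>*A)\<^sup>1\<^sup>/\<^sup>2\<close>; for closed densely defined \<open>A\<close> there is exactly one such \<open>B\<close>.\<close>

definition is_modulus :: "('v, 'm) hspace_scheme \<Rightarrow> ('v \<times> 'v) set \<Rightarrow> ('v \<times> 'v) set \<Rightarrow> bool" where
  "is_modulus H A B \<longleftrightarrow> positive_selfadjoint H B \<and> B O B = A O adjoint_op H A"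


section \<open>Spectral measures\<close>

definition orth_projection :: "('v, 'm) hspace_scheme \<Rightarrow> ('v \<Rightarrow> 'v) \<Rightarrow> bool" where
  "orth_projection H P \<longleftrightarrow>
     (\<forall>x\<in>hcarrier H. P x \<in> hcarrier H \<and> P (P x) = P x) \<and>
     (\<forall>x\<in>hcarrier H. \<forall>y\<in>hcarrier H. P (hadd H x y) = hadd H (P x) (P y)) \<and>
     (\<forall>c. \<forall>x\<in>hcarrier H. P (hscale H c x) = hscale H c (P x)) \<and>
     (\<forall>x\<in>hcarrier H. \<forall>y\<in>hcarrier H. hinner H (P x) y = hinner H x (P y))"

text \<open>
  Only the \<open>\<sigma>\<close>-algebra of \<open>N\<close> matters. Countable additivity is meant in the weak operator topology,
  which for projections is the same as in the strong one.
\<close>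

definition spectral_measure ::
    "('v, 'm) hspace_scheme \<Rightarrow> 'b measure \<Rightarrow> ('b set \<Rightarrow> 'v \<Rightarrow> 'v) \<Rightarrow> bool" where
  "spectral_measure H N E \<longleftrightarrow>
     (\<forall>\<Delta>\<in>sets N. orth_projection H (E \<Delta>)) \<and>
     (\<forall>x\<in>hcarrier H. E (space N) x = x) \<and>
     (\<forall>D :: nat \<Rightarrow> 'b set. range D \<subseteq> sets N \<and> disjoint_family D \<longrightarrow>
        (\<forall>x\<in>hcarrier H. \<forall>y\<in>hcarrier H.
           (\<lambda>n. hinner H (E (D n) x) y) sums hinner H (E (\<Union>n. D n) x) y))"

text \<open>The finite measure \<open>\<Delta> \<mapsto> \<langle>E(\<Delta>)x, x\<rangle>\<close>.\<close>

definition spectral_distr ::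
    "('v, 'm) hspace_scheme \<Rightarrow> 'b measure \<Rightarrow> ('b set \<Rightarrow> 'v \<Rightarrow> 'v) \<Rightarrow> 'v \<Rightarrow> 'b measure" where
  "spectral_distr H N E x =
     measure_of (space N) (sets N) (\<lambda>\<Delta>. ennreal (Re (hinner H (E \<Delta> x) x)))"

abbreviation borel_nonneg :: "real measure" where
  "borel_nonneg \<equiv> restrict_space borel {0..}"

text \<open>
  \<open>E\<close> is the spectral measure \<open>E\<^sub>B\<close> of the positive selfadjoint operator \<open>B\<close>, i.e.
  \<open>B = \<integral>\<^bsub>[0,\<infinity>)\<^esub> t dE(t)\<close>. The operator on the right has domain
  \<open>{x. \<integral> t\<^sup>2 d\<langle>E(t)x, x\<rangle> < \<infinity>}\<close>, and by polarization its values are determined by the quadratic form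
  \<open>x \<mapsto> \<integral> t d\<langle>E(t)x, x\<rangle>\<close> on this domain. By the spectral theorem \<open>E\<close> exists and is unique (on Borel
  sets and vectors of the space).
\<close>

definition is_spectral_measure_of ::
    "('v, 'm) hspace_scheme \<Rightarrow> ('v \<times> 'v) set \<Rightarrow> (real set \<Rightarrow> 'v \<Rightarrow> 'v) \<Rightarrow> bool" where
  "is_spectral_measure_of H B E \<longleftrightarrow>
     spectral_measure H borel_nonneg E \<and>
     Domain B =
       {x\<in>hcarrier H. (\<integral>\<^sup>+ t. ennreal (t\<^sup>2) \<partial>spectral_distr H borel_nonneg E x) < \<infinity>} \<and>
     (\<forall>(x, y)\<in>B. hinner H y x = of_real (\<integral>t. t \<partial>spectral_distr H borel_nonneg E x))"

definition graph_on :: "('v, 'm) hspace_scheme \<Rightarrow> ('v \<Rightarrow> 'v) \<Rightarrow> ('v \<times> 'v) set" where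
  "graph_on H P = {(x, P x) | x. x \<in> hcarrier H}"

text \<open>The last line says \<open>E(\<Delta>) A \<subseteq> A E(\<Delta>)\<close>, where \<open>E\<close> is the spectral measure of \<open>B = |A|\<close>.\<close>

definition quasinormal :: "('v, 'm) hspace_scheme \<Rightarrow> ('v \<times> 'v) set \<Rightarrow> bool" where
  "quasinormal H A \<longleftrightarrow>
     linear_op H A \<and> closed_op H A \<and> densely_defined H A \<and>
     (\<exists>B E. is_modulus H A B \<and> is_spectral_measure_of H B E \<and>
        (\<forall>\<Delta>\<in>sets borel_nonneg. A O graph_on H (E \<Delta>) \<subseteq> graph_on H (E \<Delta>) O A))"


section \<open>The space \<open>L\<^sup>2(\<mu>)\<close>\<close>

definition sq_integrable :: "'a measure \<Rightarrow> ('a \<Rightarrow> complex) set" where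
  "sq_integrable M = {f \<in> borel_measurable M. integrable M (\<lambda>x. (cmod (f x))\<^sup>2)}"

definition ae_class :: "'a measure \<Rightarrow> ('a \<Rightarrow> complex) \<Rightarrow> ('a \<Rightarrow> complex) set" where
  "ae_class M f = {g \<in> borel_measurable M. AE x in M. g x = f x}"

definition ae_rep :: "('a \<Rightarrow> complex) set \<Rightarrow> 'a \<Rightarrow> complex" where
  "ae_rep F = (SOME f. f \<in> F)"

definition L2 :: "'a measure \<Rightarrow> ('a \<Rightarrow> complex) set hspace" where
  "L2 M =
     \<lparr>hcarrier = ae_class M ` sq_integrable M,
      hadd = (\<lambda>F G. ae_class M (\<lambda>x. ae_rep F x + ae_rep G x)),
      hscale = (\<lambda>c F. ae_class M (\<lambda>x. c * ae_rep F x)),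
      hinner = (\<lambda>F G. \<integral>x. ae_rep F x * cnj (ae_rep G x) \<partial>M)\<rparr>"

lemma ae_rep_ae_class:
  assumes "f \<in> borel_measurable M"
  shows "ae_rep (ae_class M f) \<in> borel_measurable M"
    and "AE x in M. ae_rep (ae_class M f) x = f x"
proof -
  have "f \<in> ae_class M f"
    using assms by (simp add: ae_class_def)
  then have "ae_rep (ae_class M f) \<in> ae_class M f"
    unfolding ae_rep_def by (rule someI[where P = "\<lambda>k. k \<in> ae_class M f"])
  then show "ae_rep (ae_class M f) \<in> borel_measurable M"
    and "AE x in M. ae_rep (ae_class M f) x = f x"
    by (auto simp: ae_class_def)
qed

lemma ae_class_eqI:
  assumes "AE x in M. f x = g x"
  shows "ae_class M f = ae_class M g"
proof -
  have "(AE x in M. k x = f x) \<longleftrightarrow> (AE x in M. k x = g x)" for k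
  proof
    show "AE x in M. k x = g x" if "AE x in M. k x = f x"
      using that assms by eventually_elim simp
    show "AE x in M. k x = f x" if "AE x in M. k x = g x"
      using that assms by eventually_elim simp
  qed
  then show ?thesis by (simp add: ae_class_def)
qed

lemma L2_ops_ae_class:
  assumes f: "f \<in> borel_measurable M" and g: "g \<in> borel_measurable M"
  shows "hadd (L2 M) (ae_class M f) (ae_class M g) = ae_class M (\<lambda>x. f x + g x)"
    and "hscale (L2 M) c (ae_class M f) = ae_class M (\<lambda>x. c * f x)"
    and "hinner (L2 M) (ae_class M f) (ae_class M g) = (\<integral>x. f x * cnj (g x) \<partial>M)"
proof -
  note [measurable] = f g ae_rep_ae_class(1)[OF f] ae_rep_ae_class(1)[OF g]
  note ae = ae_rep_ae_class(2)[OF f] ae_rep_ae_class(2)[OF g]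
  show "hadd (L2 M) (ae_class M f) (ae_class M g) = ae_class M (\<lambda>x. f x + g x)"
    unfolding L2_def hspace.simps by (rule ae_class_eqI) (use ae in eventually_elim, simp)
  show "hscale (L2 M) c (ae_class M f) = ae_class M (\<lambda>x. c * f x)"
    unfolding L2_def hspace.simps by (rule ae_class_eqI) (use ae(1) in eventually_elim, simp)
  have cm [measurable]: "cnj \<in> borel_measurable borel"
    by (intro borel_measurable_continuous_onI continuous_intros)
  show "hinner (L2 M) (ae_class M f) (ae_class M g) = (\<integral>x. f x * cnj (g x) \<partial>M)"
    unfolding L2_def hspace.simps
    by (rule integral_cong_AE; (measurable)?) (use ae in eventually_elim, simp)
qed


section \<open>Composition operators\<close>

definition nonsingular :: "'a measure \<Rightarrow> ('a \<Rightarrow> 'a) \<Rightarrow> bool" where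
  "nonsingular M \<phi> \<longleftrightarrow> \<phi> \<in> measurable M M \<and> absolutely_continuous M (distr M M \<phi>)"

text \<open>For nonsingular \<open>\<phi>\<close> the class of \<open>f \<circ> \<phi>\<close> depends only on the class of \<open>f\<close>.\<close>

definition comp_op :: "'a measure \<Rightarrow> ('a \<Rightarrow> 'a) \<Rightarrow> (('a \<Rightarrow> complex) set \<times> ('a \<Rightarrow> complex) set) set" where
  "comp_op M \<phi> =
     {(ae_class M f, ae_class M (f \<circ> \<phi>)) | f. f \<in> sq_integrable M \<and> f \<circ> \<phi> \<in> sq_integrable M}"

definition h_deriv :: "'a measure \<Rightarrow> ('a \<Rightarrow> 'a) \<Rightarrow> 'a \<Rightarrow> ennreal" where
  "h_deriv M \<phi> = RN_deriv M (distr M M \<phi>)"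

lemma h_deriv:
  assumes "sigma_finite_measure M" "nonsingular M \<phi>"
  shows "h_deriv M \<phi> \<in> borel_measurable M"
    and "\<Delta> \<in> sets M \<Longrightarrow> emeasure M (\<phi> -` \<Delta> \<inter> space M) = (\<integral>\<^sup>+x\<in>\<Delta>. h_deriv M \<phi> x \<partial>M)"
proof -
  show m: "h_deriv M \<phi> \<in> borel_measurable M"
    by (simp add: h_deriv_def)
  assume D: "\<Delta> \<in> sets M"
  have "density M (h_deriv M \<phi>) = distr M M \<phi>"
    using assms by (simp add: h_deriv_def nonsingular_def sigma_finite_measure.density_RN_deriv)
  then have "emeasure (distr M M \<phi>) \<Delta> = emeasure (density M (h_deriv M \<phi>)) \<Delta>"
    by simp
  then show "emeasure M (\<phi> -` \<Delta> \<inter> space M) = (\<integral>\<^sup>+x\<in>\<Delta>. h_deriv M \<phi> x \<partial>M)"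
    using assms D m by (simp add: emeasure_distr emeasure_density nonsingular_def)
qed

end

theory Submission
  imports Defs
begin

text \<open>
  A density argument shows that \<open>h = h_deriv M \<phi>\<close> is finite almost everywhere, and then \<open>C\<^sup>* C\<close> is
  multiplication by \<open>h\<close>. If \<open>h = h \<circ> \<phi>\<close>, multiplication by \<open>\<surd>h\<close> is a modulus of \<open>C\<close>, and its spectral
  projections, which are multiplications by indicators of \<open>{\<surd>h \<in> \<Delta>}\<close>, commute with \<open>C\<close>.

  Conversely, let \<open>B\<close> be any modulus with spectral measure \<open>E\<close>, so that \<open>B\<^sup>2\<close> is multiplication by \<open>h\<close>.
  Since \<open>E(\<Delta>)\<close> commutes with \<open>B\<^sup>2\<close>, it commutes with the indicators of \<open>{h \<le> c}\<close>. On the range of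
  \<open>E([0,s])\<close> one has \<open>\<parallel>B y\<parallel> \<le> s \<parallel>y\<parallel>\<close>, and on the range of \<open>E((s,\<infinity>))\<close> one has \<open>\<parallel>B y\<parallel> > s \<parallel>y\<parallel>\<close> unless
  \<open>y = 0\<close>; together these identify \<open>E([0,s])\<close> with multiplication by the indicator of \<open>{h \<le> s\<^sup>2}\<close>.
  Commutation with \<open>C\<close>, tested on indicator functions, then says that \<open>h \<le> s\<^sup>2\<close> holds exactly where
  \<open>h \<circ> \<phi> \<le> s\<^sup>2\<close>, for every rational \<open>s > 0\<close>. No uniqueness theorem for \<open>B\<close> or \<open>E\<close> is needed.
\<close>

section \<open>Inner products and spectral measures\<close>

text \<open>The record \<open>hspace\<close> has no zero vector, so definiteness is phrased through
  differences of two vectors.\<close>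

locale inner_hspace =
  fixes H :: "('v, 'm) hspace_scheme"
  assumes add_closed: "x \<in> hcarrier H \<Longrightarrow> y \<in> hcarrier H \<Longrightarrow> hadd H x y \<in> hcarrier H"
    and scale_closed: "x \<in> hcarrier H \<Longrightarrow> hscale H c x \<in> hcarrier H"
    and inner_add_left: "x \<in> hcarrier H \<Longrightarrow> y \<in> hcarrier H \<Longrightarrow> z \<in> hcarrier H \<Longrightarrow>
      hinner H (hadd H x y) z = hinner H x z + hinner H y z"
    and inner_scale_left: "x \<in> hcarrier H \<Longrightarrow> z \<in> hcarrier H \<Longrightarrow>
      hinner H (hscale H c x) z = c * hinner H x z"
    and inner_commute: "x \<in> hcarrier H \<Longrightarrow> y \<in> hcarrier H \<Longrightarrow> hinner H x y = cnj (hinner H y x)"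
    and inner_nonneg: "x \<in> hcarrier H \<Longrightarrow> 0 \<le> Re (hinner H x x)"
    and inner_definite: "x \<in> hcarrier H \<Longrightarrow> y \<in> hcarrier H \<Longrightarrow>
      hinner H (hadd H x (hscale H (-1) y)) (hadd H x (hscale H (-1) y)) = 0 \<Longrightarrow> x = y"
begin

lemma inner_add_right:
  assumes "x \<in> hcarrier H" "y \<in> hcarrier H" "z \<in> hcarrier H"
  shows "hinner H z (hadd H x y) = hinner H z x + hinner H z y"
  using assms inner_commute[of z "hadd H x y"] inner_commute[of z x] inner_commute[of z y]
  by (simp add: add_closed inner_add_left)

lemma inner_scale_right:
  assumes "x \<in> hcarrier H" "z \<in> hcarrier H"
  shows "hinner H z (hscale H c x) = cnj c * hinner H z x"
  using assms inner_commute[of z "hscale H c x"] inner_commute[of z x]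
  by (simp add: scale_closed inner_scale_left)

lemmas inner_rules = add_closed scale_closed inner_add_left inner_scale_left
  inner_add_right inner_scale_right

lemma inner_self_real:
  assumes "x \<in> hcarrier H"
  shows "hinner H x x = of_real (Re (hinner H x x))"
  using inner_commute[OF assms assms] by (metis Reals_cnj_iff of_real_Re)

text \<open>Nondegeneracy: expanding the squared norm of \<open>x - y\<close> in its left argument
  gives a difference of two terms that agree for the choice \<open>z = x - y\<close>.\<close>

lemma inner_eqI:
  assumes x: "x \<in> hcarrier H" and y: "y \<in> hcarrier H"
    and eq: "\<And>z. z \<in> hcarrier H \<Longrightarrow> hinner H x z = hinner H y z"
  shows "x = y"
  by (rule inner_definite[OF x y]) (use x y eq in \<open>simp add: inner_rules\<close>)

text \<open>Pythagoras: \<open>x - P x\<close> is orthogonal to \<open>P x\<close>, so its squared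
  norm is the difference of the two sides.\<close>

lemma orth_projection_contraction:
  assumes P: "orth_projection H P" and x: "x \<in> hcarrier H"
  shows "Re (hinner H (P x) (P x)) \<le> Re (hinner H x x)"
proof -
  have Px: "P x \<in> hcarrier H" "hinner H (P x) x = hinner H (P x) (P x)"
    using P x unfolding orth_projection_def by metis+
  have "0 \<le> Re (hinner H (hadd H x (hscale H (-1) (P x))) (hadd H x (hscale H (-1) (P x))))"
    by (intro inner_nonneg inner_rules x Px)
  also have "\<dots> = Re (hinner H x x) - Re (hinner H (P x) (P x))"
    using Px x inner_commute[OF x Px(1)] by (simp add: inner_rules)
  finally show ?thesis by simp
qed

text \<open>The vector \<open>hscale H 0 x\<close> serves as zero: its difference from
  \<open>x\<close> has the same norm as \<open>x\<close>, so definiteness identifies the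
  two.\<close>

lemma inner_self_eq_0:
  assumes x: "x \<in> hcarrier H" and "hinner H x x = 0" and z: "z \<in> hcarrier H"
  shows "hinner H x z = 0"
proof -
  have "x = hscale H 0 x"
    by (rule inner_definite) (use x assms in \<open>simp_all add: inner_rules\<close>)
  then have "hinner H x z = hinner H (hscale H 0 x) z"
    by simp
  then show ?thesis
    using x z by (simp add: inner_scale_left)
qed

end

locale spectral_hspace = inner_hspace H for H :: "('v, 'm) hspace_scheme" +
  fixes N :: "'b measure" and E :: "'b set \<Rightarrow> 'v \<Rightarrow> 'v"
  assumes spectral: "spectral_measure H N E"
begin

section \<open>Additivity and multiplicativity of a spectral measure\<close>

lemma orth_projection_E: "A \<in> sets N \<Longrightarrow> orth_projection H (E A)"
  using spectral by (simp add: spectral_measure_def)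

lemma E_closed: "A \<in> sets N \<Longrightarrow> x \<in> hcarrier H \<Longrightarrow> E A x \<in> hcarrier H"
  and E_idem: "A \<in> sets N \<Longrightarrow> x \<in> hcarrier H \<Longrightarrow> E A (E A x) = E A x"
  and E_add: "A \<in> sets N \<Longrightarrow> x \<in> hcarrier H \<Longrightarrow> y \<in> hcarrier H \<Longrightarrow>
    E A (hadd H x y) = hadd H (E A x) (E A y)"
  and E_scale: "A \<in> sets N \<Longrightarrow> x \<in> hcarrier H \<Longrightarrow> E A (hscale H c x) = hscale H c (E A x)"
  and E_symmetric: "A \<in> sets N \<Longrightarrow> x \<in> hcarrier H \<Longrightarrow> y \<in> hcarrier H \<Longrightarrow>
    hinner H (E A x) y = hinner H x (E A y)"
  using orth_projection_E[of A] by (auto simp: orth_projection_def)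

lemma E_space: "x \<in> hcarrier H \<Longrightarrow> E (space N) x = x"
  using spectral by (simp add: spectral_measure_def)

lemma E_sums:
  assumes "range D \<subseteq> sets N" "disjoint_family (D :: nat \<Rightarrow> 'b set)" "x \<in> hcarrier H" "y \<in> hcarrier H"
  shows "(\<lambda>n. hinner H (E (D n) x) y) sums hinner H (E (\<Union>n. D n) x) y"
  using spectral assms by (simp add: spectral_measure_def)

text \<open>Additivity along the constant sequence of empty sets makes a series with constant terms
  converge, so the term is 0.\<close>

lemma inner_E_empty:
  assumes x: "x \<in> hcarrier H" and y: "y \<in> hcarrier H"
  shows "hinner H (E {} x) y = 0"
proof -
  have "(\<lambda>n::nat. hinner H (E {} x) y) sums hinner H (E {} x) y"
    using E_sums[of "\<lambda>_. {}" x y] x y by (simp add: disjoint_family_on_def)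
  then have "(\<lambda>n::nat. hinner H (E {} x) y) \<longlonglongrightarrow> 0"
    by (blast intro: summable_LIMSEQ_zero sums_summable)
  then show ?thesis
    by (simp add: LIMSEQ_const_iff)
qed

text \<open>Finite additivity from countable additivity: \<open>binaryset\<close> continues
  \<open>A\<close>, \<open>B\<close> with empty sets, which contribute 0.\<close>

lemma inner_E_Un:
  assumes AB: "A \<in> sets N" "B \<in> sets N" "A \<inter> B = {}" and x: "x \<in> hcarrier H" and y: "y \<in> hcarrier H"
  shows "hinner H (E (A \<union> B) x) y = hinner H (E A x) y + hinner H (E B x) y"
proof -
  have "(\<lambda>n. hinner H (E (binaryset A B n) x) y) sums hinner H (E (\<Union>n. binaryset A B n) x) y"
    using AB x y by (intro E_sums)
      (auto simp: range_binaryset_eq disjoint_family_on_def binaryset_def)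
  moreover have "(\<lambda>n. hinner H (E (binaryset A B n) x) y) sums
      (hinner H (E A x) y + hinner H (E B x) y)"
    using binaryset_sums[of "\<lambda>D. hinner H (E D x) y"] inner_E_empty[OF x y] by simp
  ultimately show ?thesis
    by (metis UN_binaryset_eq sums_unique2)
qed

text \<open>Two projections whose sum is again a projection have orthogonal ranges. For
  \<open>u\<close> in the range of \<open>E B\<close>, expanding the squared norm of
  \<open>E (A \<union> B) u\<close> shows that this vector is orthogonal to \<open>E A u\<close>.
  Expanding that relation in turn leaves twice the squared norm of \<open>E A u\<close>.\<close>

lemma inner_E_disjoint:
  assumes AB: "A \<in> sets N" "B \<in> sets N" "A \<inter> B = {}" and x: "x \<in> hcarrier H" and y: "y \<in> hcarrier H"
  shows "hinner H (E A (E B x)) y = 0"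
proof -
  define u where "u = E B x"
  have u: "u \<in> hcarrier H" and uB: "E B u = u"
    using AB x by (simp_all add: u_def E_closed E_idem)
  have U: "A \<union> B \<in> sets N" using AB by simp
  have *: "hinner H (E (A \<union> B) v) w = hinner H (E A v) w + hinner H (E B v) w"
    if "v \<in> hcarrier H" "w \<in> hcarrier H" for v w
    using inner_E_Un AB that by blast
  have c: "E A u \<in> hcarrier H" "E (A \<union> B) u \<in> hcarrier H" "E B u \<in> hcarrier H"
    using AB u U by (simp_all add: E_closed del: Un_iff)
  have "hinner H (E (A \<union> B) u) u = hinner H (E (A \<union> B) u) (E (A \<union> B) u)"
    using E_symmetric[OF U c(2) u] E_idem[OF U u] by simp
  also have "\<dots> = hinner H (E A u) (E (A \<union> B) u) + hinner H u (E (A \<union> B) u)"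
    using *[OF u c(2)] uB by simp
  also have "hinner H (E A u) (E (A \<union> B) u) = cnj (hinner H (E (A \<union> B) u) (E A u))"
    by (rule inner_commute[OF c(1,2)])
  also have "hinner H u (E (A \<union> B) u) = hinner H (E (A \<union> B) u) u"
    using E_symmetric[OF U u u] by simp
  finally have "hinner H (E (A \<union> B) u) (E A u) = 0" by simp
  then have "hinner H (E A u) (E A u) + hinner H u (E A u) = 0"
    using *[OF u c(1)] uB by simp
  moreover have "hinner H u (E A u) = hinner H (E A u) (E A u)"
    using E_symmetric[OF AB(1) u c(1)] E_idem[OF AB(1) u] by simp
  ultimately have "hinner H (E A u) (E A u) = 0"
    by simp
  then show ?thesis
    using inner_self_eq_0[OF c(1) _ y] by (simp add: u_def)
qed

text \<open>Multiplicativity: \<open>A\<close> and \<open>B\<close> are cut into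
  \<open>A \<inter> B\<close> and the two differences. Products over disjoint pieces vanish, and the
  remaining product is idempotent.\<close>

lemma E_Int:
  assumes AB: "A \<in> sets N" "B \<in> sets N" and x: "x \<in> hcarrier H"
  shows "E A (E B x) = E (A \<inter> B) x"
proof (rule inner_eqI)
  fix y assume y: "y \<in> hcarrier H"
  have s: "A \<inter> B \<in> sets N" "A - B \<in> sets N" "B - A \<in> sets N"
    using AB by auto
  have d: "(A \<inter> B) \<inter> (B - A) = {}" "A \<inter> B \<union> (B - A) = B"
    by auto
  have u: "E B x \<in> hcarrier H" and w: "E (A \<inter> B) y \<in> hcarrier H"
    using AB x y by (simp_all add: E_closed)
  have "hinner H (E A (E B x)) y = hinner H (E (A \<inter> B) (E B x)) y + hinner H (E (A - B) (E B x)) y"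
    using inner_E_Un[OF s(1,2) _ u y] by (simp add: Int_Diff_Un Int_Diff_disjoint)
  also have "hinner H (E (A - B) (E B x)) y = 0"
    using inner_E_disjoint[OF s(2) AB(2) _ x y] by auto
  also have "hinner H (E (A \<inter> B) (E B x)) y = hinner H (E B x) (E (A \<inter> B) y)"
    by (rule E_symmetric[OF s(1) u y])
  also have "\<dots> = hinner H (E (A \<inter> B) x) (E (A \<inter> B) y) + hinner H (E (B - A) x) (E (A \<inter> B) y)"
    using inner_E_Un[OF s(1,3) d(1) x w] unfolding d(2) .
  also have "hinner H (E (A \<inter> B) x) (E (A \<inter> B) y) = hinner H (E (A \<inter> B) x) y"
    using E_symmetric[OF s(1) _ y, of "E (A \<inter> B) x"] E_idem[OF s(1) x] E_closed[OF s(1) x] by simp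
  also have "hinner H (E (B - A) x) (E (A \<inter> B) y) = hinner H (E (A \<inter> B) (E (B - A) x)) y"
    using E_symmetric[OF s(1) _ y] E_closed[OF s(3) x] by simp
  also have "\<dots> = 0"
    using inner_E_disjoint[OF s(1,3) _ x y] by auto
  finally show "hinner H (E A (E B x)) y = hinner H (E (A \<inter> B) x) y"
    by simp
qed (use AB x in \<open>simp_all add: E_closed\<close>)

lemma E_split:
  assumes A: "A \<in> sets N" and x: "x \<in> hcarrier H"
  shows "x = hadd H (E A x) (E (space N - A) x)"
proof (rule inner_eqI)
  have A': "space N - A \<in> sets N" "A \<union> (space N - A) = space N"
    using A sets.sets_into_space[OF A] by blast+
  fix y assume y: "y \<in> hcarrier H"
  show "hinner H x y = hinner H (hadd H (E A x) (E (space N - A) x)) y"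
    using inner_E_Un[OF A A'(1) _ x y] x y A A'(1)
    unfolding A'(2) by (simp add: E_space E_closed inner_rules)
qed (use A x in \<open>simp_all add: E_closed inner_rules\<close>)

lemma inner_E_self:
  assumes "A \<in> sets N" "x \<in> hcarrier H"
  shows "hinner H (E A x) x = of_real (Re (hinner H (E A x) x))" "0 \<le> Re (hinner H (E A x) x)"
proof -
  have c: "E A x \<in> hcarrier H" using assms by (rule E_closed)
  have "hinner H (E A x) x = hinner H (E A x) (E A x)"
    using E_symmetric[OF assms(1) c assms(2)] E_idem[OF assms] by simp
  then show "hinner H (E A x) x = of_real (Re (hinner H (E A x) x))" "0 \<le> Re (hinner H (E A x) x)"
    using inner_self_real[OF c] inner_nonneg[OF c] by simp_all
qed

section \<open>Scalar distributions of a vector\<close>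

abbreviation \<mu> :: "'v \<Rightarrow> 'b measure" where "\<mu> x \<equiv> spectral_distr H N E x"

lemma space_spectral_distr [simp]: "space (\<mu> x) = space N"
  and sets_spectral_distr [simp, measurable_cong]: "sets (\<mu> x) = sets N"
  by (simp_all add: spectral_distr_def sets.space_closed)

text \<open>\<open>measure_of\<close> takes the prescribed values only if they form a measure, so
  positivity and countable additivity have to be supplied.\<close>

lemma emeasure_spectral_distr:
  assumes x: "x \<in> hcarrier H" and A: "A \<in> sets N"
  shows "emeasure (\<mu> x) A = ennreal (Re (hinner H (E A x) x))"
proof (rule emeasure_measure_of[OF spectral_distr_def])
  show "positive (sets (\<mu> x)) (\<lambda>A. ennreal (Re (hinner H (E A x) x)))"
    using inner_E_empty[OF x x] by (simp add: positive_def)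
  show "countably_additive (sets (\<mu> x)) (\<lambda>A. ennreal (Re (hinner H (E A x) x)))"
  proof (rule countably_additiveI)
    fix D :: "nat \<Rightarrow> 'b set"
    assume D: "range D \<subseteq> sets (\<mu> x)" "disjoint_family D"
    then have "(\<lambda>n. Re (hinner H (E (D n) x) x)) sums Re (hinner H (E (\<Union>n. D n) x) x)"
      by (intro sums_Re E_sums x) auto
    moreover have "0 \<le> Re (hinner H (E (D n) x) x)" for n
      using D x by (intro inner_E_self) auto
    ultimately show "(\<Sum>n. ennreal (Re (hinner H (E (D n) x) x))) = ennreal (Re (hinner H (E (\<Union>n. D n) x) x))"
      by (intro suminf_ennreal_eq)
  qed
qed (use A sets.space_closed in auto)

lemma emeasure_spectral_distr_space:
  "x \<in> hcarrier H \<Longrightarrow> emeasure (\<mu> x) (space N) = ennreal (Re (hinner H x x))"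
  by (simp add: emeasure_spectral_distr E_space)

lemma finite_measure_spectral_distr: "x \<in> hcarrier H \<Longrightarrow> finite_measure (\<mu> x)"
  by (rule finite_measureI) (simp add: emeasure_spectral_distr_space)

lemma measure_spectral_distr_space:
  "x \<in> hcarrier H \<Longrightarrow> measure (\<mu> x) (space N) = Re (hinner H x x)"
  by (simp add: measure_def emeasure_spectral_distr_space inner_nonneg)

text \<open>Multiplicativity gives \<open>E G (E A (E G x)) = E (G \<inter> A) x\<close>. This turns
  statements about the range of \<open>E G\<close> into statements about measures restricted to
  \<open>G\<close>.\<close>

lemma spectral_distr_E:
  assumes x: "x \<in> hcarrier H" and G: "G \<in> sets N"
  shows "\<mu> (E G x) = density (\<mu> x) (indicator G)"
proof (rule measure_eqI)
  fix A assume "A \<in> sets (\<mu> (E G x))"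
  then have A: "A \<in> sets N" by simp
  have "hinner H (E A (E G x)) (E G x) = hinner H (E G (E A (E G x))) x"
    using E_symmetric[OF G _ x, of "E A (E G x)"] A G x by (simp add: E_closed)
  also have "\<dots> = hinner H (E (G \<inter> A) x) x"
    using A G x by (simp add: E_Int E_closed Int_ac)
  finally show "emeasure (\<mu> (E G x)) A = emeasure (density (\<mu> x) (indicator G)) A"
    using A G x by (simp add: emeasure_spectral_distr emeasure_restricted E_closed)
qed simp

lemma spectral_distr_cong:
  assumes "x \<in> hcarrier H" "y \<in> hcarrier H"
    and "\<And>A. A \<in> sets N \<Longrightarrow> hinner H (E A x) x = hinner H (E A y) y"
  shows "\<mu> x = \<mu> y"
  by (rule measure_eqI) (use assms in \<open>simp_all add: emeasure_spectral_distr\<close>)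

end

section \<open>A positive selfadjoint operator and its spectral measure\<close>

locale spectral_operator = spectral_hspace H borel_nonneg E
  for H :: "('v, 'm) hspace_scheme" and E :: "real set \<Rightarrow> 'v \<Rightarrow> 'v" +
  fixes B :: "('v \<times> 'v) set"
  assumes psa: "positive_selfadjoint H B"
    and spectral_of: "is_spectral_measure_of H B E"
begin

lemma linear_B: "linear_op H B"
  using psa by (simp add: positive_selfadjoint_def)

lemma B_closed:
  assumes "(x, y) \<in> B"
  shows "x \<in> hcarrier H" "y \<in> hcarrier H"
proof -
  have "B \<subseteq> hcarrier H \<times> hcarrier H"
    using linear_B by (simp add: linear_op_def)
  then show "x \<in> hcarrier H" "y \<in> hcarrier H"
    using assms by blast+
qed

lemma B_fun: "(x, y) \<in> B \<Longrightarrow> (x, y') \<in> B \<Longrightarrow> y = y'"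
  by (rule single_valuedD[of B]) (use linear_B in \<open>simp_all add: linear_op_def\<close>)

lemma B_add:
  assumes "(x, y) \<in> B" "(x', y') \<in> B"
  shows "(hadd H x x', hadd H y y') \<in> B"
proof -
  have "\<forall>(x, y)\<in>B. \<forall>(x', y')\<in>B. (hadd H x x', hadd H y y') \<in> B"
    using linear_B unfolding linear_op_def by (elim conjE)
  from bspec[OF this assms(1)] have "\<forall>(x', y')\<in>B. (hadd H x x', hadd H y y') \<in> B"
    unfolding prod.case .
  from bspec[OF this assms(2)] show ?thesis
    unfolding prod.case .
qed

lemma B_scale:
  assumes "(x, y) \<in> B"
  shows "(hscale H c x, hscale H c y) \<in> B"
proof -
  have "\<forall>(x, y)\<in>B. (hscale H c x, hscale H c y) \<in> B"
    using linear_B unfolding linear_op_def by (elim conjE) (erule spec)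
  from bspec[OF this assms] show ?thesis
    by simp
qed

lemma B_nonneg: "(x, y) \<in> B \<Longrightarrow> 0 \<le> Re (hinner H y x)"
  and B_adjoint: "adjoint_op H B = B"
  using psa by (auto simp: positive_selfadjoint_def)

lemma B_symmetric: "(x, x') \<in> B \<Longrightarrow> (y, y') \<in> B \<Longrightarrow> hinner H x' y = hinner H x y'"
  using B_adjoint unfolding adjoint_op_def by blast

text \<open>Selfadjointness used as maximality: a pair that satisfies the symmetry relation with the
  whole graph already belongs to the graph.\<close>

lemma B_adjointI:
  assumes "y \<in> hcarrier H" "z \<in> hcarrier H" "\<And>x x'. (x, x') \<in> B \<Longrightarrow> hinner H x' y = hinner H x z"
  shows "(y, z) \<in> B"
  using assms by (subst B_adjoint[symmetric]) (auto simp: adjoint_op_def)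

lemma Domain_B_iff:
  "x \<in> Domain B \<longleftrightarrow> x \<in> hcarrier H \<and> (\<integral>\<^sup>+ t. ennreal (t\<^sup>2) \<partial>\<mu> x) < \<infinity>"
  and B_form: "(x, y) \<in> B \<Longrightarrow> hinner H y x = of_real (\<integral>t. t \<partial>\<mu> x)"
  using spectral_of by (auto simp: is_spectral_measure_of_def)

lemma borel_nonneg_measurable [measurable]: "(\<lambda>t. t) \<in> borel_measurable borel_nonneg"
  by (simp add: measurable_restrict_space1)

text \<open>The distribution of \<open>E G x\<close> is that of \<open>x\<close> restricted to
  \<open>G\<close>; for a fixed vector the two coincide.\<close>

lemma AE_spectral_distr:
  assumes "x \<in> hcarrier H" "G \<in> sets borel_nonneg" "E G x = x"
  shows "AE t in \<mu> x. t \<in> G"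
proof -
  have "AE t in density (\<mu> x) (indicator G). t \<in> G"
    using assms by (subst AE_density) (auto simp: indicator_def split: if_splits)
  moreover have "density (\<mu> x) (indicator G) = \<mu> x"
    using spectral_distr_E[OF assms(1,2)] assms(3) by simp
  ultimately show ?thesis
    by metis
qed

lemma emeasure_spectral_distr_nonneg:
  "x \<in> hcarrier H \<Longrightarrow> emeasure (\<mu> x) {0..} = ennreal (Re (hinner H x x))"
  and measure_spectral_distr_nonneg:
  "x \<in> hcarrier H \<Longrightarrow> measure (\<mu> x) {0..} = Re (hinner H x x)"
  using emeasure_spectral_distr_space[of x] measure_spectral_distr_space[of x] by simp_all

text \<open>Restriction to \<open>G\<close> can only lower the second moment.\<close>

lemma Domain_B_E:
  assumes x: "x \<in> Domain B" and G: "G \<in> sets borel_nonneg"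
  shows "E G x \<in> Domain B"
proof -
  have c: "x \<in> hcarrier H" "(\<integral>\<^sup>+ t. ennreal (t\<^sup>2) \<partial>\<mu> x) < \<infinity>"
    using x by (simp_all add: Domain_B_iff)
  have "(\<integral>\<^sup>+ t. ennreal (t\<^sup>2) \<partial>\<mu> (E G x)) = (\<integral>\<^sup>+ t. indicator G t * ennreal (t\<^sup>2) \<partial>\<mu> x)"
    using G by (simp add: spectral_distr_E c(1) nn_integral_density)
  also have "\<dots> \<le> (\<integral>\<^sup>+ t. ennreal (t\<^sup>2) \<partial>\<mu> x)"
    by (intro nn_integral_mono) (simp add: indicator_def)
  finally show ?thesis
    using c G by (simp add: Domain_B_iff E_closed order.strict_trans1)
qed

text \<open>The distribution lives on \<open>{0..s}\<close>, so its second moment is at most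
  \<open>s^2\<close> times its finite mass.\<close>

lemma Domain_B_bounded:
  assumes x: "x \<in> hcarrier H" and E: "E {0..s} x = x"
  shows "x \<in> Domain B"
proof -
  interpret finite_measure "\<mu> x" by (rule finite_measure_spectral_distr[OF x])
  have s: "{0..s} \<in> sets borel_nonneg"
    by (auto simp: sets_restrict_space_iff)
  have "(\<integral>\<^sup>+ t. ennreal (t\<^sup>2) \<partial>\<mu> x) \<le> (\<integral>\<^sup>+ t. ennreal (s\<^sup>2) \<partial>\<mu> x)"
    by (rule nn_integral_mono_AE) (use AE_spectral_distr[OF x s E] in \<open>eventually_elim, auto intro!: ennreal_leI power_mono\<close>)
  also have "\<dots> < \<infinity>"
    using x by (simp add: ennreal_mult_less_top emeasure_spectral_distr_nonneg)
  finally show ?thesis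
    using x by (simp add: Domain_B_iff)
qed

text \<open>The distribution of \<open>p + w q\<close> with \<open>p\<close>, \<open>q\<close> in the ranges of \<open>E G\<close> and of its complement does
  not depend on the unimodular number \<open>w\<close>; polarization then kills the cross terms of the form.\<close>

lemma B_cross_zero:
  assumes xz: "x \<in> hcarrier H" "z \<in> hcarrier H" and G: "G \<in> sets borel_nonneg" "G' \<in> sets borel_nonneg" "G \<inter> G' = {}"
    and B: "(E G x, u) \<in> B" "(E G' z, v) \<in> B"
  shows "hinner H u (E G' z) = 0"
proof -
  define p q where "p = E G x" and "q = E G' z"
  note [simp] = B_closed[OF B(1)[folded p_def]] B_closed[OF B(2)[folded q_def]]
  have *: "hinner H (hadd H u (hscale H w v)) (hadd H p (hscale H w q)) =
      hinner H (hadd H u v) (hadd H p q)" if w: "w * cnj w = 1" for w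
  proof -
    have "\<mu> (hadd H p (hscale H w q)) = \<mu> (hadd H p q)"
    proof (rule spectral_distr_cong)
      fix A :: "real set" assume A: "A \<in> sets borel_nonneg"
      \<comment> \<open>The mixed terms vanish because \<open>G\<close> and \<open>G'\<close> are
        disjoint, so \<open>w\<close> enters the distribution of \<open>p + w q\<close> only through
        \<open>w * cnj w\<close>.\<close>
      have "hinner H (E A p) q = hinner H (E G' (E A p)) z"
        using E_symmetric[OF G(2) _ xz(2), of "E A p"] A by (simp add: q_def E_closed)
      also have "E G' (E A p) = E (G' \<inter> A) (E G x)"
        using E_Int[OF G(2) A, of p] by (simp add: p_def[symmetric])
      also have "hinner H \<dots> z = 0"
        using G A xz by (intro inner_E_disjoint) auto
      finally have 1: "hinner H (E A p) q = 0" .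
      have "hinner H (E A q) p = hinner H (E G (E A q)) x"
        using E_symmetric[OF G(1) _ xz(1), of "E A q"] A by (simp add: p_def E_closed)
      also have "E G (E A q) = E (G \<inter> A) (E G' z)"
        using E_Int[OF G(1) A, of q] by (simp add: q_def[symmetric])
      also have "hinner H \<dots> x = 0"
        using G A xz by (intro inner_E_disjoint) auto
      finally have 2: "hinner H (E A q) p = 0" .
      have "cnj w * w = 1"
        using w by (simp add: mult.commute)
      then show "hinner H (E A (hadd H p (hscale H w q))) (hadd H p (hscale H w q)) =
          hinner H (E A (hadd H p q)) (hadd H p q)"
        using A by (simp add: E_add E_scale E_closed inner_rules 1 2)
    qed (simp_all add: inner_rules)
    then show ?thesis
      using B_form[OF B_add[OF B(1) B_scale[OF B(2), of w]]] B_form[OF B_add[OF B(1) B(2)]]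
      by (simp add: p_def q_def)
  qed
  define a b where "a = hinner H u q" and "b = hinner H v p"
  \<comment> \<open>The cross terms of the form at \<open>p + w q\<close> are
    \<open>cnj w * a + w * b\<close>, and they must equal \<open>a + b\<close>. The choice
    \<open>w = -1\<close> gives \<open>a + b = 0\<close>, and \<open>w = \<i>\<close> then gives
    \<open>b = a\<close>.\<close>
  have "2 * b + 2 * a = 0"
    using *[of "-1"] by (simp add: inner_rules a_def b_def)
  moreover have "a + b = (2 * b + 2 * a) / 2"
    by simp
  ultimately have "a + b = 0"
    by simp
  moreover have "\<i> * b = \<i> * a + (a + b)"
    using *[of "\<i>"] by (simp add: inner_rules a_def b_def algebra_simps)
  ultimately have "a = 0" by (simp add: add_eq_0_iff)
  then show ?thesis
    by (simp add: a_def q_def)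
qed

text \<open>The link between \<open>B\<close> and \<open>E\<close> is given only by the domain and
  the quadratic form, so commutation has to be derived. Writing \<open>B z\<close> for the value at
  \<open>z\<close> and dropping cross terms twice, \<open><B z, E G x> = <B (E G z), E G x> = <B (E
  G z), x> = <E G z, y> = <z, E G y>\<close>, and \<open>B_adjointI\<close> applies.\<close>

lemma B_E:
  assumes B: "(x, y) \<in> B" and G: "G \<in> sets borel_nonneg"
  shows "(E G x, E G y) \<in> B"
proof (rule B_adjointI)
  note c [simp] = B_closed[OF B]
  define G' where "G' = space borel_nonneg - G"
  have G': "G' \<in> sets borel_nonneg" "G \<inter> G' = {}" "G' \<inter> G = {}"
    using G unfolding G'_def by blast+
  have split: "v = hadd H (E G v) (E G' v)" if v: "v \<in> hcarrier H" for v
    unfolding G'_def by (rule E_split[OF G v])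
  fix z z' assume z: "(z, z') \<in> B"
  note zc [simp] = B_closed[OF z]
  obtain q q' where q: "(E G z, q) \<in> B" and q': "(E G' z, q') \<in> B"
    using Domain_B_E z G G'(1) by blast
  obtain p p' where p: "(E G x, p) \<in> B" and p': "(E G' x, p') \<in> B"
    using Domain_B_E B G G'(1) by blast
  note [simp] = B_closed[OF q] B_closed[OF q'] B_closed[OF p] B_closed[OF p']
  have "z' = hadd H q q'"
    using B_fun[OF z, of "hadd H q q'"] B_add[OF q q'] split[of z] by simp
  then have "hinner H z' (E G x) = hinner H q (E G x)"
    using B_cross_zero[OF _ _ G'(1) G G'(3) q' p] by (simp add: inner_rules)
  also have "\<dots> = hinner H q x"
  proof -
    have "hinner H q x = hinner H q (hadd H (E G x) (E G' x))"
      using split[of x] by simp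
    also have "\<dots> = hinner H q (E G x)"
      using B_cross_zero[OF _ _ G G'(1,2) q p'] by (simp add: inner_rules)
    finally show ?thesis ..
  qed
  also have "\<dots> = hinner H (E G z) y"
    by (rule B_symmetric[OF q B])
  also have "\<dots> = hinner H z (E G y)"
    by (simp add: E_symmetric G)
  finally show "hinner H z' (E G x) = hinner H z (E G y)" .
qed (use B_closed[OF B] G in \<open>simp_all add: E_closed\<close>)

section \<open>Form bounds for \<open>B O B\<close> on the ranges of spectral projections\<close>

lemma B_form_le:
  assumes B: "(x, y) \<in> B" and E: "E {0..s} x = x"
  shows "Re (hinner H y x) \<le> s * Re (hinner H x x)"
proof -
  have x: "x \<in> hcarrier H" by (rule B_closed[OF B])
  interpret finite_measure "\<mu> x" by (rule finite_measure_spectral_distr[OF x])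
  have "{0..s} \<in> sets borel_nonneg"
    by (auto simp: sets_restrict_space_iff)
  from AE_spectral_distr[OF x this E] have AE: "AE t in \<mu> x. t \<in> {0..s}" .
  have "(\<integral>t. t \<partial>\<mu> x) \<le> (\<integral>t. s \<partial>\<mu> x)"
    using AE by (intro integral_mono_AE integrable_const_bound[where B = s]) auto
  then show ?thesis
    using B_form[OF B] x by (simp add: measure_spectral_distr_nonneg mult.commute)
qed

text \<open>With \<open>y = B x\<close>, the form of \<open>B O B\<close> at \<open>x\<close> is the
  squared norm of \<open>y\<close>. Positivity of \<open>B\<close> at \<open>y - s x\<close>,
  combined with \<open>B_form_le\<close> at \<open>x\<close> and at \<open>y\<close>, bounds it by
  \<open>s^2\<close> times the squared norm of \<open>x\<close>.\<close>

lemma B_square_form_le: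
  assumes x: "x \<in> hcarrier H" and E: "E {0..s} x = x" and s: "0 < s"
  obtains z where "(x, z) \<in> B O B" "Re (hinner H z x) \<le> s\<^sup>2 * Re (hinner H x x)"
proof -
  have S: "{0..s} \<in> sets borel_nonneg"
    by (auto simp: sets_restrict_space_iff)
  obtain y where y: "(x, y) \<in> B"
    using Domain_B_bounded[OF x E] by (rule DomainE)
  \<comment> \<open>Commutation keeps \<open>y\<close> in the range of \<open>E {0..s}\<close>,
    which puts \<open>y\<close> in the domain of \<open>B\<close> as well.\<close>
  have "(x, E {0..s} y) \<in> B"
    using B_E[OF y S] E by simp
  then have Ey: "E {0..s} y = y"
    using y by (rule B_fun)
  have yc: "y \<in> hcarrier H" by (rule B_closed[OF y])
  obtain z where z: "(y, z) \<in> B"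
    using Domain_B_bounded[OF yc Ey] by (rule DomainE)
  have zc: "z \<in> hcarrier H" by (rule B_closed[OF z])
  note c = x yc zc
  have zx: "hinner H z x = hinner H y y"
    by (rule B_symmetric[OF z y])
  have "0 \<le> Re (hinner H (hadd H z (hscale H (-of_real s) y)) (hadd H y (hscale H (-of_real s) x)))"
    by (intro B_nonneg B_add z B_scale y)
  also have "\<dots> = Re (hinner H z y) - 2 * s * Re (hinner H y y) + s\<^sup>2 * Re (hinner H y x)"
    using c by (simp add: inner_rules zx power2_eq_square algebra_simps)
  also have "\<dots> \<le> s * Re (hinner H y y) - 2 * s * Re (hinner H y y) + s\<^sup>2 * (s * Re (hinner H x x))"
    using B_form_le[OF z Ey] mult_left_mono[OF B_form_le[OF y E], of "s\<^sup>2"] by simp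
  also have "\<dots> = s * (s\<^sup>2 * Re (hinner H x x) - Re (hinner H y y))"
    by (simp add: algebra_simps power2_eq_square)
  finally have "Re (hinner H z x) \<le> s\<^sup>2 * Re (hinner H x x)"
    using s zx by (simp add: zero_le_mult_iff)
  then show ?thesis
    using y z that by blast
qed

text \<open>With \<open>y = B x\<close>, the squared norm of \<open>y - s x\<close> is nonnegative;
  under the bound \<open>le\<close> this says that the mean of \<open>t\<close> is at most
  \<open>s\<close> times the total mass. But \<open>t > s\<close> almost everywhere, so the mass is
  0.\<close>

lemma B_square_form_gt:
  assumes z: "(x, z) \<in> B O B" and E: "E {s<..} x = x" and s: "0 < s"
    and le: "Re (hinner H z x) \<le> s\<^sup>2 * Re (hinner H x x)"
  shows "hinner H x x = 0"
proof -
  obtain y where y: "(x, y) \<in> B" and z: "(y, z) \<in> B"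
    using z by blast
  note c = B_closed[OF y] B_closed[OF z]
  interpret finite_measure "\<mu> x" by (rule finite_measure_spectral_distr[OF c(1)])
  have "{s<..} \<in> sets borel_nonneg"
    using s by (auto simp: sets_restrict_space_iff)
  from AE_spectral_distr[OF c(1) this E] have AE: "AE t in \<mu> x. t \<in> {s<..}" .
  have "integrable (\<mu> x) (\<lambda>t. t\<^sup>2)"
    using y Domain_B_iff[of x] by (intro integrableI_nonneg) auto
  \<comment> \<open>A finite second moment on a finite measure gives a finite first moment, by
    \<open>\<bar>t\<bar> \<le> 1 + t^2\<close>.\<close>
  then have int: "integrable (\<mu> x) (\<lambda>t. t)"
  proof (rule Bochner_Integration.integrable_bound[OF Bochner_Integration.integrable_add[OF integrable_const[of 1]]])
    show "AE t in \<mu> x. norm t \<le> norm (1 + t\<^sup>2)"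
    proof (rule AE_I2)
      fix t :: real
      have "0 \<le> (\<bar>t\<bar> - 1)\<^sup>2" by simp
      then have "\<bar>t\<bar> \<le> 1 + t\<^sup>2"
        by (simp add: power2_diff)
      then show "norm t \<le> norm (1 + t\<^sup>2)" by simp
    qed
  qed simp
  have "0 \<le> Re (hinner H (hadd H y (hscale H (-of_real s) x)) (hadd H y (hscale H (-of_real s) x)))"
    using c by (intro inner_nonneg) (simp add: inner_rules)
  also have "\<dots> = Re (hinner H y y) - 2 * s * Re (hinner H y x) + s\<^sup>2 * Re (hinner H x x)"
    using c inner_commute[OF c(1,2)] by (simp add: inner_rules power2_eq_square algebra_simps)
  also have "\<dots> \<le> 2 * s * (s * Re (hinner H x x) - Re (hinner H y x))"
    using le B_symmetric[OF z y] by (simp add: algebra_simps power2_eq_square)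
  finally have "(\<integral>t. t \<partial>\<mu> x) \<le> s * Re (hinner H x x)"
    using s B_form[OF y] by (simp add: zero_le_mult_iff)
  then have "(\<integral>t. t - s \<partial>\<mu> x) \<le> 0"
    using c int by (simp add: measure_spectral_distr_nonneg mult.commute)
  moreover have "0 \<le> (\<integral>t. t - s \<partial>\<mu> x)"
    using AE by (intro integral_nonneg_AE) auto
  ultimately have "AE t in \<mu> x. t - s = 0"
    using int AE by (subst integral_nonneg_eq_0_iff_AE[symmetric]) auto
  \<comment> \<open>\<open>t = s\<close> contradicts \<open>t > s\<close>, so the distribution is
    the zero measure; its total mass is the squared norm of \<open>x\<close>.\<close>
  with AE have "AE t in \<mu> x. False"
    by eventually_elim simp
  then have "(\<integral>\<^sup>+t. 1 \<partial>\<mu> x) = (\<integral>\<^sup>+t. 0 \<partial>\<mu> x)"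
    by (intro nn_integral_cong_AE) simp
  then have "Re (hinner H x x) = 0"
    using c inner_nonneg[of x] by (simp add: emeasure_spectral_distr_nonneg)
  then show ?thesis
    using inner_self_real[OF c(1)] by simp
qed

end

section \<open>Multiplication operators\<close>

lemma borel_measurable_cnj [measurable]: "cnj \<in> borel_measurable borel"
  by (intro borel_measurable_continuous_onI continuous_intros)

lemma sq_integrable_measurable: "f \<in> sq_integrable M \<Longrightarrow> f \<in> borel_measurable M"
  and sq_integrable_integrable: "f \<in> sq_integrable M \<Longrightarrow> integrable M (\<lambda>x. (cmod (f x))\<^sup>2)"
  by (simp_all add: sq_integrable_def)

lemma sq_integrable_iff_nn_integral:
  assumes "f \<in> borel_measurable M"
  shows "f \<in> sq_integrable M \<longleftrightarrow> (\<integral>\<^sup>+x. ennreal ((cmod (f x))\<^sup>2) \<partial>M) < \<infinity>"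
  using assms by (simp add: sq_integrable_def integrable_iff_bounded)

lemma sq_integrable_bound:
  assumes f: "f \<in> sq_integrable M" and g: "g \<in> borel_measurable M"
    and le: "AE x in M. cmod (g x) \<le> c * cmod (f x)"
  shows "g \<in> sq_integrable M"
proof -
  have "integrable M (\<lambda>x. (cmod (g x))\<^sup>2)"
  proof (rule Bochner_Integration.integrable_bound)
    show "integrable M (\<lambda>x. c\<^sup>2 * (cmod (f x))\<^sup>2)"
      using sq_integrable_integrable[OF f] by simp
    show "AE x in M. norm ((cmod (g x))\<^sup>2) \<le> norm (c\<^sup>2 * (cmod (f x))\<^sup>2)"
      using le by eventually_elim (drule power_mono[where n = 2], simp_all add: power_mult_distrib)
  qed (use g in measurable)
  then show ?thesis
    using g by (simp add: sq_integrable_def)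
qed

lemma sq_integrable_cong_AE:
  assumes "f \<in> sq_integrable M" "g \<in> borel_measurable M" "AE x in M. g x = f x"
  shows "g \<in> sq_integrable M"
  by (rule sq_integrable_bound[OF assms(1,2), of 1]) (use assms(3) in \<open>eventually_elim, simp\<close>)

lemma sq_integrable_add:
  assumes f: "f \<in> sq_integrable M" and g: "g \<in> sq_integrable M"
  shows "(\<lambda>x. f x + g x) \<in> sq_integrable M"
proof -
  note [measurable] = sq_integrable_measurable[OF f] sq_integrable_measurable[OF g]
  have "integrable M (\<lambda>x. (cmod (f x + g x))\<^sup>2)"
  proof (rule Bochner_Integration.integrable_bound)
    show "integrable M (\<lambda>x. 2 * (cmod (f x))\<^sup>2 + 2 * (cmod (g x))\<^sup>2)"
      using sq_integrable_integrable[OF f] sq_integrable_integrable[OF g] by simp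
    show "AE x in M. norm ((cmod (f x + g x))\<^sup>2) \<le> norm (2 * (cmod (f x))\<^sup>2 + 2 * (cmod (g x))\<^sup>2)"
    proof (rule AE_I2)
      fix x
      have "(cmod (f x + g x))\<^sup>2 \<le> (cmod (f x) + cmod (g x))\<^sup>2"
        by (intro power_mono norm_triangle_ineq) simp
      also have "\<dots> \<le> 2 * (cmod (f x))\<^sup>2 + 2 * (cmod (g x))\<^sup>2"
        using sum_squares_bound[of "cmod (f x)" "cmod (g x)"] by (simp add: power2_sum)
      finally show "norm ((cmod (f x + g x))\<^sup>2) \<le> norm (2 * (cmod (f x))\<^sup>2 + 2 * (cmod (g x))\<^sup>2)"
        by simp
    qed
  qed simp
  then show ?thesis
    by (simp add: sq_integrable_def)
qed

lemma sq_integrable_scale: "f \<in> sq_integrable M \<Longrightarrow> (\<lambda>x. c * f x) \<in> sq_integrable M"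
  by (rule sq_integrable_bound[where c = "cmod c"]) (auto simp: norm_mult intro: borel_measurable_times sq_integrable_measurable)

lemma sq_integrable_diff:
  "f \<in> sq_integrable M \<Longrightarrow> g \<in> sq_integrable M \<Longrightarrow> (\<lambda>x. f x - g x) \<in> sq_integrable M"
  using sq_integrable_add[of f M "\<lambda>x. - 1 * g x"] sq_integrable_scale[of g M "-1"] by simp

lemma sq_integrable_indicator_mult:
  assumes f: "f \<in> sq_integrable M" and A: "A \<in> sets N" and p: "p \<in> measurable M N"
  shows "(\<lambda>x. indicator A (p x) * f x) \<in> sq_integrable M"
  by (rule sq_integrable_bound[OF f, of _ 1])
    (use A p sq_integrable_measurable[OF f] in \<open>auto simp: indicator_def norm_mult\<close>)

lemma sq_integrable_indicator:
  assumes "A \<in> sets M" "emeasure M A < \<infinity>"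
  shows "indicator A \<in> sq_integrable M"
proof -
  have "(\<integral>\<^sup>+x. ennreal ((cmod (indicator A x))\<^sup>2) \<partial>M) = (\<integral>\<^sup>+x. indicator A x \<partial>M)"
    by (intro nn_integral_cong) (simp add: indicator_def)
  then show ?thesis
    using assms by (simp add: sq_integrable_iff_nn_integral)
qed

lemma cmod_inner_le: "cmod (a * cnj b) \<le> (cmod a)\<^sup>2 + (cmod b)\<^sup>2"
proof -
  have "2 * (cmod a * cmod b) \<le> (cmod a)\<^sup>2 + (cmod b)\<^sup>2" "0 \<le> cmod a * cmod b"
    using sum_squares_bound[of "cmod a" "cmod b"] by simp_all
  then show ?thesis
    unfolding norm_mult complex_mod_cnj by linarith
qed

lemma sq_integrable_inner:
  assumes f: "f \<in> sq_integrable M" and g: "g \<in> sq_integrable M"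
  shows "integrable M (\<lambda>x. f x * cnj (g x))"
proof -
  note [measurable] = sq_integrable_measurable[OF f] sq_integrable_measurable[OF g]
  show ?thesis
  proof (rule Bochner_Integration.integrable_bound)
    show "integrable M (\<lambda>x. (cmod (f x))\<^sup>2 + (cmod (g x))\<^sup>2)"
      using sq_integrable_integrable[OF f] sq_integrable_integrable[OF g] by simp
    show "AE x in M. norm (f x * cnj (g x)) \<le> norm ((cmod (f x))\<^sup>2 + (cmod (g x))\<^sup>2)"
      using cmod_inner_le by (intro AE_I2) simp
  qed simp
qed

section \<open>The inner product space of classes of square integrable functions\<close>

lemma ae_class_eq_iff:
  assumes "f \<in> borel_measurable M" "g \<in> borel_measurable M"
  shows "ae_class M f = ae_class M g \<longleftrightarrow> (AE x in M. f x = g x)"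
proof
  assume "ae_class M f = ae_class M g"
  moreover have "f \<in> ae_class M f"
    using assms by (simp add: ae_class_def)
  ultimately show "AE x in M. f x = g x"
    by (simp add: ae_class_def)
qed (rule ae_class_eqI)

lemma hcarrier_L2 [simp]: "hcarrier (L2 M) = ae_class M ` sq_integrable M"
  by (simp add: L2_def)

lemma L2_add: "f \<in> sq_integrable M \<Longrightarrow> g \<in> sq_integrable M \<Longrightarrow>
    hadd (L2 M) (ae_class M f) (ae_class M g) = ae_class M (\<lambda>x. f x + g x)"
  and L2_scale: "f \<in> sq_integrable M \<Longrightarrow> hscale (L2 M) c (ae_class M f) = ae_class M (\<lambda>x. c * f x)"
  and L2_inner: "f \<in> sq_integrable M \<Longrightarrow> g \<in> sq_integrable M \<Longrightarrow>
    hinner (L2 M) (ae_class M f) (ae_class M g) = (\<integral>x. f x * cnj (g x) \<partial>M)"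
  by (auto intro!: L2_ops_ae_class sq_integrable_measurable)

lemma L2_norm:
  assumes "f \<in> sq_integrable M"
  shows "hinner (L2 M) (ae_class M f) (ae_class M f) = of_real (\<integral>x. (cmod (f x))\<^sup>2 \<partial>M)"
  unfolding L2_inner[OF assms assms] complex_norm_square[symmetric] by (rule integral_complex_of_real)

lemma L2_norm_eq_0:
  assumes "f \<in> sq_integrable M"
  shows "hinner (L2 M) (ae_class M f) (ae_class M f) = 0 \<longleftrightarrow> (AE x in M. f x = 0)"
  using integral_nonneg_eq_0_iff_AE[OF sq_integrable_integrable[OF assms]]
  by (simp add: L2_norm assms)

lemma L2_diff:
  assumes "f \<in> sq_integrable M" "g \<in> sq_integrable M"
  shows "hadd (L2 M) (ae_class M f) (hscale (L2 M) (-1) (ae_class M g)) = ae_class M (\<lambda>x. f x - g x)"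
  using assms L2_add[OF assms(1) sq_integrable_scale[OF assms(2), of "-1"]]
  by (simp add: L2_scale)

lemma hdist_L2:
  assumes "f \<in> sq_integrable M" "g \<in> sq_integrable M"
  shows "hdist (L2 M) (ae_class M f) (ae_class M g) = sqrt (\<integral>x. (cmod (f x - g x))\<^sup>2 \<partial>M)"
  using assms by (simp add: hdist_def L2_diff[simplified] L2_norm sq_integrable_diff)

lemma nn_integral_hdist_L2:
  assumes "f \<in> sq_integrable M" "g \<in> sq_integrable M"
  shows "(\<integral>\<^sup>+x. ennreal ((cmod (f x - g x))\<^sup>2) \<partial>M) = ennreal ((hdist (L2 M) (ae_class M f) (ae_class M g))\<^sup>2)"
  using sq_integrable_integrable[OF sq_integrable_diff[OF assms]]
  by (simp add: hdist_L2 assms nn_integral_eq_integral)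

lemma inner_hspace_L2: "inner_hspace (L2 M)"
proof
  fix F G K :: "('a \<Rightarrow> complex) set"
  assume F: "F \<in> hcarrier (L2 M)"
  then obtain f where f: "f \<in> sq_integrable M" "F = ae_class M f" by auto
  show "hscale (L2 M) c F \<in> hcarrier (L2 M)" for c
    using f by (auto simp: L2_scale sq_integrable_scale)
  show "0 \<le> Re (hinner (L2 M) F F)"
    using f by (simp add: L2_norm)
  assume G: "G \<in> hcarrier (L2 M)"
  then obtain g where g: "g \<in> sq_integrable M" "G = ae_class M g" by auto
  show "hadd (L2 M) F G \<in> hcarrier (L2 M)"
    using f g by (auto simp: L2_add sq_integrable_add)
  show "hinner (L2 M) F G = cnj (hinner (L2 M) G F)"
    using f g Bochner_Integration.integral_cnj[of M "\<lambda>x. g x * cnj (f x)"] by (simp add: L2_inner mult.commute)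
  show "hinner (L2 M) (hscale (L2 M) c F) G = c * hinner (L2 M) F G" for c
    using f g by (simp add: L2_inner L2_scale sq_integrable_scale mult.assoc)
  show "F = G" if "hinner (L2 M) (hadd (L2 M) F (hscale (L2 M) (-1) G)) (hadd (L2 M) F (hscale (L2 M) (-1) G)) = 0"
    using that f g by (simp add: L2_diff[simplified] L2_norm_eq_0 sq_integrable_diff sq_integrable_measurable ae_class_eq_iff)
  assume K: "K \<in> hcarrier (L2 M)"
  then obtain k where k: "k \<in> sq_integrable M" "K = ae_class M k" by auto
  show "hinner (L2 M) (hadd (L2 M) F G) K = hinner (L2 M) F K + hinner (L2 M) G K"
    using f g k by (simp add: L2_inner L2_add sq_integrable_add sq_integrable_inner distrib_right)
qed

section \<open>Multiplication by a real function on its maximal domain\<close>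

definition mult_op :: "'a measure \<Rightarrow> ('a \<Rightarrow> real) \<Rightarrow> (('a \<Rightarrow> complex) set \<times> ('a \<Rightarrow> complex) set) set" where
  "mult_op M g = {(ae_class M f, ae_class M (\<lambda>x. of_real (g x) * f x)) | f.
     f \<in> sq_integrable M \<and> (\<lambda>x. of_real (g x) * f x) \<in> sq_integrable M}"

lemma mult_opI:
  "f \<in> sq_integrable M \<Longrightarrow> (\<lambda>x. of_real (g x) * f x) \<in> sq_integrable M \<Longrightarrow>
    (ae_class M f, ae_class M (\<lambda>x. of_real (g x) * f x)) \<in> mult_op M g"
  by (auto simp: mult_op_def)

lemma mult_opE:
  assumes "(F, G) \<in> mult_op M g"
  obtains f where "f \<in> sq_integrable M" "(\<lambda>x. of_real (g x) * f x) \<in> sq_integrable M"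
    "F = ae_class M f" "G = ae_class M (\<lambda>x. of_real (g x) * f x)"
  using assms by (auto simp: mult_op_def)

text \<open>Allows membership in the graph to be tested on any chosen representatives, in place of
  those hidden in the existential of \<open>mult_op\<close>.\<close>

lemma mult_op_iff:
  assumes g [measurable]: "g \<in> borel_measurable M" and f: "f \<in> sq_integrable M" and k: "k \<in> sq_integrable M"
  shows "(ae_class M f, ae_class M k) \<in> mult_op M g \<longleftrightarrow> (AE x in M. k x = of_real (g x) * f x)"
proof
  note [measurable] = sq_integrable_measurable[OF f] sq_integrable_measurable[OF k]
  assume "(ae_class M f, ae_class M k) \<in> mult_op M g"
  then obtain f' where f': "f' \<in> sq_integrable M" "ae_class M f = ae_class M f'"
      "ae_class M k = ae_class M (\<lambda>x. of_real (g x) * f' x)"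
    by (rule mult_opE)
  note [measurable] = sq_integrable_measurable[OF f'(1)]
  have "AE x in M. f x = f' x" "AE x in M. k x = of_real (g x) * f' x"
    using f'(2,3) by (simp_all add: ae_class_eq_iff)
  then show "AE x in M. k x = of_real (g x) * f x"
    by eventually_elim simp
next
  note [measurable] = sq_integrable_measurable[OF f] sq_integrable_measurable[OF k]
  assume eq: "AE x in M. k x = of_real (g x) * f x"
  have "AE x in M. of_real (g x) * f x = k x"
    using eq by eventually_elim simp
  then have "(\<lambda>x. of_real (g x) * f x) \<in> sq_integrable M"
    by (intro sq_integrable_cong_AE[OF k]) simp_all
  from mult_opI[OF f this] show "(ae_class M f, ae_class M k) \<in> mult_op M g"
    using ae_class_eqI[OF eq] by simp
qed

lemma mult_op_closed: "mult_op M g \<subseteq> hcarrier (L2 M) \<times> hcarrier (L2 M)"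
  by (auto simp: mult_op_def)

lemma sq_integrable_truncate:
  assumes g [measurable]: "g \<in> borel_measurable M" and f: "f \<in> sq_integrable M"
    and supp: "\<And>x. f x \<noteq> 0 \<Longrightarrow> \<bar>g x\<bar> \<le> c"
  shows "(\<lambda>x. of_real (g x) * f x) \<in> sq_integrable M"
proof (rule sq_integrable_bound[OF f])
  note [measurable] = sq_integrable_measurable[OF f]
  show "(\<lambda>x. of_real (g x) * f x) \<in> borel_measurable M"
    by measurable
  have "cmod (of_real (g x) * f x) \<le> c * cmod (f x)" for x
    using supp[of x] by (cases "f x = 0") (simp_all add: norm_mult mult_right_mono)
  then show "AE x in M. cmod (of_real (g x) * f x) \<le> c * cmod (f x)"
    by simp
qed

text \<open>Common core of the adjoint computations for multiplication and for composition. The test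
  functions live where \<open>g\<close> is bounded, so that they lie in the domains involved.
  Testing with the truncation of \<open>g f - k\<close> makes its norm vanish, and the bounds
  \<open>n\<close> exhaust the space.\<close>

lemma mult_op_test:
  assumes g [measurable]: "g \<in> borel_measurable M" and f: "f \<in> sq_integrable M" and k: "k \<in> sq_integrable M"
    and test: "\<And>u n. u \<in> sq_integrable M \<Longrightarrow> (\<And>x. u x \<noteq> 0 \<Longrightarrow> \<bar>g x\<bar> \<le> real n) \<Longrightarrow>
      (\<integral>x. of_real (g x) * u x * cnj (f x) \<partial>M) = (\<integral>x. u x * cnj (k x) \<partial>M)"
  shows "AE x in M. k x = of_real (g x) * f x"
proof -
  note [measurable] = sq_integrable_measurable[OF f] sq_integrable_measurable[OF k]
  have "AE x in M. \<bar>g x\<bar> \<le> real n \<longrightarrow> k x = of_real (g x) * f x" for n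
  proof -
    define I :: "'a \<Rightarrow> complex" where "I x = indicator {..real n} \<bar>g x\<bar>" for x
    define d where "d x = of_real (g x) * (I x * f x) - I x * k x" for x
    have If: "(\<lambda>x. I x * f x) \<in> sq_integrable M" and Ik: "(\<lambda>x. I x * k x) \<in> sq_integrable M"
      using sq_integrable_indicator_mult[where A = "{..real n}" and N = borel and p = "\<lambda>x. \<bar>g x\<bar>"] f k
      by (simp_all add: I_def)
    have d: "d \<in> sq_integrable M"
      unfolding d_def by (intro sq_integrable_diff sq_integrable_truncate[where c = "real n"] If Ik g)
        (auto simp: I_def indicator_def split: if_splits)
    have supp: "\<bar>g x\<bar> \<le> real n" if "d x \<noteq> 0" for x
      using that by (auto simp: d_def I_def indicator_def split: if_splits)
    have gd: "(\<lambda>x. of_real (g x) * d x) \<in> sq_integrable M"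
      by (rule sq_integrable_truncate[OF g d supp])
    have "hinner (L2 M) (ae_class M d) (ae_class M d) = (\<integral>x. d x * cnj (d x) \<partial>M)"
      by (simp add: L2_inner d)
    \<comment> \<open>Since \<open>g\<close> is real and \<open>d\<close> vanishes off the
      truncation set, expanding \<open>cnj (d x)\<close> gives this integrand.\<close>
    also have "\<dots> = (\<integral>x. of_real (g x) * d x * cnj (f x) - d x * cnj (k x) \<partial>M)"
      by (intro Bochner_Integration.integral_cong) (auto simp: d_def I_def indicator_def algebra_simps)
    also have "\<dots> = (\<integral>x. of_real (g x) * d x * cnj (f x) \<partial>M) - (\<integral>x. d x * cnj (k x) \<partial>M)"
      by (intro Bochner_Integration.integral_diff sq_integrable_inner gd f d k)
    also have "\<dots> = 0"
      using test[OF d supp] by simp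
    finally have "AE x in M. d x = 0"
      by (simp add: L2_norm_eq_0 d)
    then show ?thesis
      by eventually_elim (auto simp: d_def I_def)
  qed
  then have "AE x in M. \<forall>n. \<bar>g x\<bar> \<le> real n \<longrightarrow> k x = of_real (g x) * f x"
    unfolding AE_all_countable by blast
  then show ?thesis
    by eventually_elim (meson real_arch_simple)
qed

lemma linear_op_mult_op:
  assumes g [measurable]: "g \<in> borel_measurable M"
  shows "linear_op (L2 M) (mult_op M g)"
proof -
  have "(\<lambda>_. 0) \<in> sq_integrable M"
    by (simp add: sq_integrable_def)
  then have "(ae_class M (\<lambda>_. 0), ae_class M (\<lambda>x. of_real (g x) * 0)) \<in> mult_op M g"
    by (intro mult_opI) simp_all
  then have ne: "mult_op M g \<noteq> {}" by blast
  have sv: "single_valued (mult_op M g)"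
  proof (rule single_valuedI)
    fix F G K assume FG: "(F, G) \<in> mult_op M g" and FK: "(F, K) \<in> mult_op M g"
    obtain f where f: "f \<in> sq_integrable M" "(\<lambda>x. of_real (g x) * f x) \<in> sq_integrable M"
        "F = ae_class M f" "G = ae_class M (\<lambda>x. of_real (g x) * f x)"
      by (rule mult_opE[OF FG])
    obtain k where k: "k \<in> sq_integrable M" "K = ae_class M k"
      using FK mult_op_closed[of M g] by auto
    have "AE x in M. k x = of_real (g x) * f x"
      using FK f k by (simp add: mult_op_iff)
    then have "AE x in M. of_real (g x) * f x = k x"
      by eventually_elim simp
    then show "G = K"
      unfolding f(4) k(2) by (rule ae_class_eqI)
  qed
  have add: "(hadd (L2 M) F F', hadd (L2 M) G G') \<in> mult_op M g"
    if FG: "(F, G) \<in> mult_op M g" "(F', G') \<in> mult_op M g" for F G F' G'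
  proof -
    obtain f where f: "f \<in> sq_integrable M" "(\<lambda>x. of_real (g x) * f x) \<in> sq_integrable M"
        "F = ae_class M f" "G = ae_class M (\<lambda>x. of_real (g x) * f x)"
      by (rule mult_opE[OF FG(1)])
    obtain f' where f': "f' \<in> sq_integrable M" "(\<lambda>x. of_real (g x) * f' x) \<in> sq_integrable M"
        "F' = ae_class M f'" "G' = ae_class M (\<lambda>x. of_real (g x) * f' x)"
      by (rule mult_opE[OF FG(2)])
    show ?thesis
      using mult_opI[OF sq_integrable_add[OF f(1) f'(1)], of g] sq_integrable_add[OF f(2) f'(2)]
      using f f' by (simp add: L2_add distrib_left)
  qed
  have scale: "(hscale (L2 M) c F, hscale (L2 M) c G) \<in> mult_op M g"
    if FG: "(F, G) \<in> mult_op M g" for c F G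
  proof -
    obtain f where f: "f \<in> sq_integrable M" "(\<lambda>x. of_real (g x) * f x) \<in> sq_integrable M"
        "F = ae_class M f" "G = ae_class M (\<lambda>x. of_real (g x) * f x)"
      by (rule mult_opE[OF FG(1)])
    show ?thesis
      using mult_opI[OF sq_integrable_scale[OF f(1), of c], of g] sq_integrable_scale[OF f(2), of c]
      using f by (simp add: L2_scale mult.left_commute)
  qed
  show ?thesis
    unfolding linear_op_def using mult_op_closed[of M g] ne sv add scale by auto
qed

text \<open>The truncations of \<open>f\<close> to \<open>\<bar>g x\<bar> \<le> n\<close> lie in the
  domain and converge to \<open>f\<close> by dominated convergence.\<close>

lemma densely_defined_mult_op:
  assumes g [measurable]: "g \<in> borel_measurable M"
  shows "densely_defined (L2 M) (mult_op M g)"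
  unfolding densely_defined_def
proof (intro ballI allI impI)
  fix F and e :: real assume "F \<in> hcarrier (L2 M)" and e: "0 < e"
  then obtain f where f: "f \<in> sq_integrable M" "F = ae_class M f" by auto
  note [measurable] = sq_integrable_measurable[OF f(1)]
  define u where "u n x = indicator {..real n} \<bar>g x\<bar> * f x" for n x
  have u: "u n \<in> sq_integrable M" for n
    unfolding u_def by (rule sq_integrable_indicator_mult[OF f(1), where N = borel]) simp_all
  have "(\<lambda>x. of_real (g x) * u n x) \<in> sq_integrable M" for n
    by (rule sq_integrable_truncate[OF g u, of _ "real n"])
      (auto simp: u_def indicator_def split: if_splits)
  then have D: "ae_class M (u n) \<in> Domain (mult_op M g)" for n
    using mult_opI[OF u] by blast
  have "(\<lambda>n. \<integral>x. (cmod (f x - u n x))\<^sup>2 \<partial>M) \<longlonglongrightarrow> (\<integral>x. 0 \<partial>M)"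
  proof (rule integral_dominated_convergence[where w = "\<lambda>x. (cmod (f x))\<^sup>2"])
    show "AE x in M. (\<lambda>n. (cmod (f x - u n x))\<^sup>2) \<longlonglongrightarrow> 0"
    proof (rule AE_I2, rule tendsto_eventually)
      fix x
      obtain N where "\<bar>g x\<bar> \<le> real N" using real_arch_simple by blast
      then show "\<forall>\<^sub>F n in sequentially. (cmod (f x - u n x))\<^sup>2 = 0"
        by (intro eventually_sequentiallyI[of N]) (simp add: u_def)
    qed
    show "AE x in M. norm ((cmod (f x - u n x))\<^sup>2) \<le> (cmod (f x))\<^sup>2" for n
      by (intro AE_I2) (simp add: u_def indicator_def)
  qed (use sq_integrable_integrable[OF f(1)] sq_integrable_measurable[OF u] in simp_all)
  then have "(\<lambda>n. sqrt (\<integral>x. (cmod (f x - u n x))\<^sup>2 \<partial>M)) \<longlonglongrightarrow> sqrt 0"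
    by (intro tendsto_real_sqrt) simp
  then have "(\<lambda>n. hdist (L2 M) F (ae_class M (u n))) \<longlonglongrightarrow> 0"
    using f u by (simp add: hdist_L2)
  then obtain n where "hdist (L2 M) F (ae_class M (u n)) < e"
    using order_tendstoD(2)[OF _ e] eventually_happens'[OF sequentially_bot] by blast
  then show "\<exists>G\<in>Domain (mult_op M g). hdist (L2 M) F G < e"
    using D by blast
qed

text \<open>Maximality of the domain leaves no room for a larger adjoint: a pair in the adjoint,
  tested on truncated functions, satisfies the multiplication equation. The converse moves the real
  factor \<open>g\<close> across the inner product.\<close>

lemma adjoint_mult_op:
  assumes g [measurable]: "g \<in> borel_measurable M"
  shows "adjoint_op (L2 M) (mult_op M g) = mult_op M g"
proof (intro set_eqI iffI; clarify)
  fix F G assume FG: "(F, G) \<in> adjoint_op (L2 M) (mult_op M g)"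
  then obtain f k where f: "f \<in> sq_integrable M" "F = ae_class M f"
      and k: "k \<in> sq_integrable M" "G = ae_class M k"
    by (auto simp: adjoint_op_def)
  have "AE x in M. k x = of_real (g x) * f x"
  proof (rule mult_op_test[OF g f(1) k(1)])
    fix u n assume u: "u \<in> sq_integrable M" "\<And>x. u x \<noteq> 0 \<Longrightarrow> \<bar>g x\<bar> \<le> real n"
    have gu: "(\<lambda>x. of_real (g x) * u x) \<in> sq_integrable M"
      by (rule sq_integrable_truncate[OF g u])
    have "hinner (L2 M) (ae_class M (\<lambda>x. of_real (g x) * u x)) F = hinner (L2 M) (ae_class M u) G"
      using FG mult_opI[OF u(1) gu] by (auto simp: adjoint_op_def)
    then show "(\<integral>x. of_real (g x) * u x * cnj (f x) \<partial>M) = (\<integral>x. u x * cnj (k x) \<partial>M)"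
      using f k u gu by (simp add: L2_inner)
  qed
  then show "(F, G) \<in> mult_op M g"
    using f k by (simp add: mult_op_iff)
next
  fix F G assume FG: "(F, G) \<in> mult_op M g"
  obtain f where f: "f \<in> sq_integrable M" "(\<lambda>x. of_real (g x) * f x) \<in> sq_integrable M"
      "F = ae_class M f" "G = ae_class M (\<lambda>x. of_real (g x) * f x)"
    by (rule mult_opE[OF FG(1)])
  have "hinner (L2 M) U' F = hinner (L2 M) U G" if UU': "(U, U') \<in> mult_op M g" for U U'
  proof -
    obtain u where u: "u \<in> sq_integrable M" "(\<lambda>x. of_real (g x) * u x) \<in> sq_integrable M"
        "U = ae_class M u" "U' = ae_class M (\<lambda>x. of_real (g x) * u x)"
      by (rule mult_opE[OF UU'])
    then show ?thesis
      using f by (simp add: L2_inner mult_ac)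
  qed
  then show "(F, G) \<in> adjoint_op (L2 M) (mult_op M g)"
    using f by (auto simp: adjoint_op_def)
qed

lemma positive_selfadjoint_mult_op:
  assumes g [measurable]: "g \<in> borel_measurable M" and pos: "\<And>x. 0 \<le> g x"
  shows "positive_selfadjoint (L2 M) (mult_op M g)"
proof -
  have "hinner (L2 M) G F \<in> \<real> \<and> 0 \<le> Re (hinner (L2 M) G F)" if FG: "(F, G) \<in> mult_op M g" for F G
  proof -
    obtain f where f: "f \<in> sq_integrable M" "(\<lambda>x. of_real (g x) * f x) \<in> sq_integrable M"
        "F = ae_class M f" "G = ae_class M (\<lambda>x. of_real (g x) * f x)"
      by (rule mult_opE[OF FG])
    have "hinner (L2 M) G F = (\<integral>x. of_real (g x * (cmod (f x))\<^sup>2) \<partial>M)"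
      unfolding of_real_mult complex_norm_square using f by (simp add: L2_inner mult.assoc)
    also have "\<dots> = of_real (\<integral>x. g x * (cmod (f x))\<^sup>2 \<partial>M)"
      by (rule integral_complex_of_real)
    finally show ?thesis
      using pos by simp
  qed
  then show ?thesis
    using linear_op_mult_op[OF g] densely_defined_mult_op[OF g] adjoint_mult_op[OF g]
    by (auto simp: positive_selfadjoint_def)
qed

text \<open>The point is equality of domains: if \<open>f\<close> and \<open>g^2 f\<close> are
  square integrable, then so is \<open>g f\<close>, because its squared modulus is the modulus of
  \<open>g^2 f * cnj f\<close>, a product of two square integrable functions.\<close>

lemma mult_op_O_mult_op:
  assumes g [measurable]: "g \<in> borel_measurable M"
  shows "mult_op M g O mult_op M g = mult_op M (\<lambda>x. (g x)\<^sup>2)"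
proof (intro set_eqI iffI; clarify)
  fix F G K assume FG: "(F, G) \<in> mult_op M g" and GK: "(G, K) \<in> mult_op M g"
  obtain f where f: "f \<in> sq_integrable M" "(\<lambda>x. of_real (g x) * f x) \<in> sq_integrable M"
      "F = ae_class M f" "G = ae_class M (\<lambda>x. of_real (g x) * f x)"
    by (rule mult_opE[OF FG])
  obtain k where k: "k \<in> sq_integrable M" "K = ae_class M k"
    using GK mult_op_closed[of M g] by auto
  have "AE x in M. k x = of_real (g x) * (of_real (g x) * f x)"
    using GK f k by (simp add: mult_op_iff)
  then show "(F, K) \<in> mult_op M (\<lambda>x. (g x)\<^sup>2)"
    using f k by (simp add: mult_op_iff power2_eq_square mult.assoc)
next
  fix F K assume FK: "(F, K) \<in> mult_op M (\<lambda>x. (g x)\<^sup>2)"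
  obtain f where f: "f \<in> sq_integrable M" "(\<lambda>x. of_real ((g x)\<^sup>2) * f x) \<in> sq_integrable M"
      "F = ae_class M f" "K = ae_class M (\<lambda>x. of_real ((g x)\<^sup>2) * f x)"
    by (rule mult_opE[OF FK])
  note [measurable] = sq_integrable_measurable[OF f(1)]
  have gf: "(\<lambda>x. of_real (g x) * f x) \<in> sq_integrable M"
  proof -
    have "integrable M (\<lambda>x. of_real ((g x)\<^sup>2) * f x * cnj (f x))"
      by (rule sq_integrable_inner[OF f(2,1)])
    then have "integrable M (\<lambda>x. norm (of_real ((g x)\<^sup>2) * f x * cnj (f x)))"
      by (rule integrable_norm)
    also have "(\<lambda>x. norm (of_real ((g x)\<^sup>2) * f x * cnj (f x))) = (\<lambda>x. (cmod (of_real (g x) * f x))\<^sup>2)"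
      by (simp add: fun_eq_iff norm_mult power_mult_distrib power2_eq_square norm_power)
    finally show ?thesis
      by (simp add: sq_integrable_def)
  qed
  have "(F, ae_class M (\<lambda>x. of_real (g x) * f x)) \<in> mult_op M g"
    unfolding f(3) by (rule mult_opI[OF f(1) gf])
  moreover have "(ae_class M (\<lambda>x. of_real (g x) * f x), K) \<in> mult_op M g"
    using f gf by (simp add: mult_op_iff power2_eq_square mult.assoc)
  ultimately show "(F, K) \<in> mult_op M g O mult_op M g"
    by blast
qed

section \<open>Spectral projections and multiplication operators\<close>

lemma orth_projectionD:
  assumes P: "orth_projection (L2 M) P" and f: "f \<in> sq_integrable M"
  obtains p where "p \<in> sq_integrable M" "P (ae_class M f) = ae_class M p"
  using assms unfolding orth_projection_def by auto

context
  fixes M :: "'a measure" and P :: "('a \<Rightarrow> complex) set \<Rightarrow> ('a \<Rightarrow> complex) set"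
    and k :: "'a \<Rightarrow> real" and c :: real
  assumes P: "orth_projection (L2 M) P"
    and k [measurable]: "k \<in> borel_measurable M" and k_nonneg: "\<And>x. 0 \<le> k x" and c: "0 \<le> c"
    and commute: "\<And>F G. (F, G) \<in> mult_op M k \<Longrightarrow> (P F, P G) \<in> mult_op M k"
begin

text \<open>If \<open>f\<close> is supported where \<open>k \<le> c\<close>, then \<open>\<parallel>k\<^sup>j P f\<parallel> = \<parallel>P k\<^sup>j f\<parallel> \<le> c\<^sup>j \<parallel>f\<parallel>\<close> for all \<open>j\<close>, and this growth
  rate leaves no room for \<open>P f\<close> where \<open>k > c\<close>.\<close>

lemma projection_supported_le:
  assumes f: "f \<in> sq_integrable M" and p: "p \<in> sq_integrable M" and Pf: "P (ae_class M f) = ae_class M p"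
    and supp: "\<And>x. f x \<noteq> 0 \<Longrightarrow> k x \<le> c"
  shows "AE x in M. p x \<noteq> 0 \<longrightarrow> k x \<le> c"
proof -
  note [measurable] = sq_integrable_measurable[OF f] sq_integrable_measurable[OF p]
  define A where "A = (\<integral>x. (cmod (f x))\<^sup>2 \<partial>M)"
  \<comment> \<open>Raised one power at a time: \<open>k^j f\<close> stays square integrable because
    \<open>f\<close> lives where \<open>k \<le> c\<close>, and commutation turns
    \<open>P (k^j f)\<close> into \<open>k^j p\<close>.\<close>
  have "(\<lambda>x. of_real (k x ^ j) * f x) \<in> sq_integrable M \<and>
      (\<exists>q\<in>sq_integrable M. P (ae_class M (\<lambda>x. of_real (k x ^ j) * f x)) = ae_class M q \<and>
        (AE x in M. q x = of_real (k x ^ j) * p x))" for j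
  proof (induction j)
    case 0
    show ?case using f p Pf by auto
  next
    case (Suc j)
    define u where "u = (\<lambda>x. of_real (k x ^ j) * f x)"
    from Suc obtain q where u: "u \<in> sq_integrable M" and q: "q \<in> sq_integrable M"
        "P (ae_class M u) = ae_class M q" "AE x in M. q x = of_real (k x ^ j) * p x"
      unfolding u_def by blast
    have ku: "(\<lambda>x. of_real (k x) * u x) \<in> sq_integrable M"
      by (rule sq_integrable_truncate[OF k u, of c]) (use supp k_nonneg in \<open>auto simp: u_def\<close>)
    obtain q' where q': "q' \<in> sq_integrable M" "P (ae_class M (\<lambda>x. of_real (k x) * u x)) = ae_class M q'"
      by (rule orth_projectionD[OF P ku])
    have "(ae_class M q, ae_class M q') \<in> mult_op M k"
      using commute[OF mult_opI[OF u ku]] q q' by simp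
    then have "AE x in M. q' x = of_real (k x) * q x"
      using q q' by (simp add: mult_op_iff)
    with q(3) have "AE x in M. q' x = of_real (k x ^ Suc j) * p x"
      by eventually_elim (simp add: mult.assoc)
    moreover have "(\<lambda>x. of_real (k x) * u x) = (\<lambda>x. of_real (k x ^ Suc j) * f x)"
      by (simp add: u_def fun_eq_iff mult.assoc)
    ultimately show ?case
      using ku q' by auto
  qed
  note powers = this
  have bound: "integrable M (\<lambda>x. (k x ^ j)\<^sup>2 * (cmod (p x))\<^sup>2) \<and> (\<integral>x. (k x ^ j)\<^sup>2 * (cmod (p x))\<^sup>2 \<partial>M) \<le> (c ^ j)\<^sup>2 * A" for j
  proof -
    define u where "u = (\<lambda>x. of_real (k x ^ j) * f x)"
    from powers[of j] obtain q where u: "u \<in> sq_integrable M" and q: "q \<in> sq_integrable M"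
        "P (ae_class M u) = ae_class M q" "AE x in M. q x = of_real (k x ^ j) * p x"
      unfolding u_def by blast
    note [measurable] = sq_integrable_measurable[OF q(1)]
    have ae: "AE x in M. (cmod (q x))\<^sup>2 = (k x ^ j)\<^sup>2 * (cmod (p x))\<^sup>2"
      using q(3) by eventually_elim (simp add: norm_mult power_mult_distrib norm_power k_nonneg)
    have int: "integrable M (\<lambda>x. (k x ^ j)\<^sup>2 * (cmod (p x))\<^sup>2)"
      using integrable_cong_AE[OF _ _ ae] sq_integrable_integrable[OF q(1)] by simp
    have "(\<integral>x. (k x ^ j)\<^sup>2 * (cmod (p x))\<^sup>2 \<partial>M) = (\<integral>x. (cmod (q x))\<^sup>2 \<partial>M)"
      using integral_cong_AE[OF _ _ ae] by simp
    also have "\<dots> \<le> (\<integral>x. (cmod (u x))\<^sup>2 \<partial>M)"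
      using inner_hspace.orth_projection_contraction[OF inner_hspace_L2 P, of "ae_class M u"] u q
      by (simp add: L2_norm)
    also have "\<dots> \<le> (\<integral>x. (c ^ j)\<^sup>2 * (cmod (f x))\<^sup>2 \<partial>M)"
    proof (rule integral_mono)
      fix x
      have "(k x ^ j)\<^sup>2 * (cmod (f x))\<^sup>2 \<le> (c ^ j)\<^sup>2 * (cmod (f x))\<^sup>2"
        using supp[of x] k_nonneg[of x] by (cases "f x = 0") (auto intro!: mult_right_mono power_mono)
      then show "(cmod (u x))\<^sup>2 \<le> (c ^ j)\<^sup>2 * (cmod (f x))\<^sup>2"
        by (simp add: u_def norm_mult power_mult_distrib norm_power k_nonneg)
    qed (use u f in \<open>simp_all add: sq_integrable_integrable\<close>)
    finally show ?thesis
      using int by (simp add: A_def)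
  qed
  \<comment> \<open>On \<open>{d \<le> k}\<close> the weight \<open>(k x ^ j)^2\<close> is at least
    \<open>(d ^ j)^2\<close>, so the mass \<open>J\<close> of \<open>p\<close> there is at most
    \<open>((c / d)^2) ^ j * A\<close> for every \<open>j\<close>, which tends to 0.\<close>
  have "AE x in M. d \<le> k x \<longrightarrow> p x = 0" if d: "c < d" for d
  proof -
    define J where "J = (\<integral>x. indicator {d..} (k x) * (cmod (p x))\<^sup>2 \<partial>M)"
    have int: "integrable M (\<lambda>x. indicator {d..} (k x) * (cmod (p x))\<^sup>2)"
      by (rule Bochner_Integration.integrable_bound[OF sq_integrable_integrable[OF p]])
        (auto simp: indicator_def)
    have "J \<le> ((c / d)\<^sup>2) ^ j * A" for j
    proof -
      have "(d ^ j)\<^sup>2 * J = (\<integral>x. (d ^ j)\<^sup>2 * (indicator {d..} (k x) * (cmod (p x))\<^sup>2) \<partial>M)"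
        by (simp add: J_def)
      also have "\<dots> \<le> (\<integral>x. (k x ^ j)\<^sup>2 * (cmod (p x))\<^sup>2 \<partial>M)"
        using int bound[of j] c d
        by (intro integral_mono) (auto simp: indicator_def intro!: mult_right_mono power_mono)
      also have "\<dots> \<le> (c ^ j)\<^sup>2 * A"
        using bound by blast
      finally show ?thesis
        using c d by (simp add: field_simps power_divide flip: power_mult)
    qed
    moreover have "(\<lambda>j. ((c / d)\<^sup>2) ^ j * A) \<longlonglongrightarrow> 0 * A"
      using c d by (intro tendsto_mult tendsto_const LIMSEQ_power_zero) (simp add: power_less_one_iff abs_square_less_1)
    ultimately have "J \<le> 0"
      by (intro LIMSEQ_le_const) auto
    moreover have "0 \<le> J"
      unfolding J_def by (intro integral_nonneg_AE) simp
    ultimately have "AE x in M. indicator {d..} (k x) * (cmod (p x))\<^sup>2 = 0"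
      using int unfolding J_def by (subst integral_nonneg_eq_0_iff_AE[symmetric]) auto
    then show ?thesis
      by eventually_elim (auto simp: indicator_def split: if_splits)
  qed
  \<comment> \<open>Countably many thresholds \<open>d\<close> decreasing to \<open>c\<close>
    exhaust the set where \<open>k > c\<close>.\<close>
  from this[of "c + inverse (real (Suc n))" for n]
  have "AE x in M. \<forall>n. c + inverse (real (Suc n)) \<le> k x \<longrightarrow> p x = 0"
    unfolding AE_all_countable by simp
  then show ?thesis
  proof eventually_elim
    case (elim x)
    show ?case
    proof (intro impI, rule ccontr)
      assume "p x \<noteq> 0" and gt: "\<not> k x \<le> c"
      obtain n where "inverse (real (Suc n)) < k x - c"
        using reals_Archimedean[of "k x - c"] gt by auto
      then show False
        using elim \<open>p x \<noteq> 0\<close> by (auto dest: spec[of _ n])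
    qed
  qed
qed

text \<open>Dual to the previous lemma. Let \<open>q\<close> be the part of \<open>p\<close> where
  \<open>k \<le> c\<close>. Symmetry of \<open>P\<close> gives
  \<open><q, q> = <p, q> = <f, P q>\<close>, and \<open>P q\<close> again lives where
  \<open>k \<le> c\<close>, whereas \<open>f\<close> vanishes there.\<close>

lemma projection_supported_gt:
  assumes f: "f \<in> sq_integrable M" and p: "p \<in> sq_integrable M" and Pf: "P (ae_class M f) = ae_class M p"
    and supp: "\<And>x. f x \<noteq> 0 \<Longrightarrow> c < k x"
  shows "AE x in M. p x \<noteq> 0 \<longrightarrow> c < k x"
proof -
  define q where "q x = indicator {..c} (k x) * p x" for x
  have q: "q \<in> sq_integrable M"
    unfolding q_def by (rule sq_integrable_indicator_mult[OF p, where N = borel]) simp_all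
  obtain q' where q': "q' \<in> sq_integrable M" "P (ae_class M q) = ae_class M q'"
    by (rule orth_projectionD[OF P q])
  have "AE x in M. q' x \<noteq> 0 \<longrightarrow> k x \<le> c"
    by (rule projection_supported_le[OF q q'(1,2)]) (auto simp: q_def indicator_def split: if_splits)
  then have 0: "AE x in M. f x * cnj (q' x) = 0"
    using supp by (auto simp: not_le[symmetric] elim!: eventually_mono)
  have "hinner (L2 M) (ae_class M q) (ae_class M q) = hinner (L2 M) (ae_class M p) (ae_class M q)"
    using p q by (auto simp: L2_inner q_def indicator_def intro!: Bochner_Integration.integral_cong)
  also have "\<dots> = hinner (L2 M) (ae_class M f) (ae_class M q')"
    using P f q unfolding orth_projection_def Pf[symmetric] q'(2)[symmetric] by simp
  also have "\<dots> = (\<integral>x. f x * cnj (q' x) \<partial>M)"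
    by (simp add: L2_inner f q')
  also have "\<dots> = 0"
    using 0 by (rule integral_eq_zero_AE)
  finally have "AE x in M. q x = 0"
    using q by (simp add: L2_norm_eq_0)
  then show ?thesis
    by eventually_elim (auto simp: q_def indicator_def split: if_splits)
qed

text \<open>The range of \<open>P\<close> is invariant under cutting at \<open>k = c\<close>:
  \<open>P e1\<close> and \<open>P e2\<close> sum to \<open>e\<close>, and by the two support lemmas
  they live on the two sides of the cut, so they are the corresponding pieces of
  \<open>e\<close>.\<close>

lemma projection_split:
  assumes e: "e \<in> sq_integrable M" and Pe: "P (ae_class M e) = ae_class M e"
  defines "e1 \<equiv> \<lambda>x. indicator {..c} (k x) * e x" and "e2 \<equiv> \<lambda>x. indicator {c<..} (k x) * e x"
  shows "P (ae_class M e1) = ae_class M e1" "P (ae_class M e2) = ae_class M e2"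
proof -
  have e1: "e1 \<in> sq_integrable M" and e2: "e2 \<in> sq_integrable M"
    using sq_integrable_indicator_mult[where A = "{..c}" and N = borel and p = k]
      sq_integrable_indicator_mult[where A = "{c<..}" and N = borel and p = k] e
    by (simp_all add: e1_def e2_def)
  obtain p1 where p1: "p1 \<in> sq_integrable M" "P (ae_class M e1) = ae_class M p1"
    by (rule orth_projectionD[OF P e1])
  obtain p2 where p2: "p2 \<in> sq_integrable M" "P (ae_class M e2) = ae_class M p2"
    by (rule orth_projectionD[OF P e2])
  have sum: "(\<lambda>x. e1 x + e2 x) = e"
    by (auto simp: e1_def e2_def indicator_def fun_eq_iff)
  have "ae_class M (\<lambda>x. p1 x + p2 x) = hadd (L2 M) (P (ae_class M e1)) (P (ae_class M e2))"
    by (simp add: p1 p2 L2_add)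
  also have "\<dots> = P (hadd (L2 M) (ae_class M e1) (ae_class M e2))"
    using P e1 e2 by (simp add: orth_projection_def)
  also have "\<dots> = ae_class M e"
    by (simp add: L2_add e1 e2 sum Pe)
  finally have "AE x in M. p1 x + p2 x = e x"
    using sq_integrable_add[OF p1(1) p2(1)] e by (simp add: ae_class_eq_iff sq_integrable_measurable)
  moreover have "AE x in M. p1 x \<noteq> 0 \<longrightarrow> k x \<le> c"
    by (rule projection_supported_le[OF e1 p1]) (auto simp: e1_def indicator_def split: if_splits)
  moreover have "AE x in M. p2 x \<noteq> 0 \<longrightarrow> c < k x"
    by (rule projection_supported_gt[OF e2 p2]) (auto simp: e2_def indicator_def split: if_splits)
  ultimately have "AE x in M. p1 x = e1 x \<and> p2 x = e2 x"
    by eventually_elim (auto simp: e1_def e2_def indicator_def)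
  then show "P (ae_class M e1) = ae_class M e1" "P (ae_class M e2) = ae_class M e2"
    unfolding p1(2) p2(2) by (auto intro!: ae_class_eqI elim: eventually_mono)
qed

end

lemma mult_op_form:
  assumes k [measurable]: "k \<in> borel_measurable M" and y: "y \<in> sq_integrable M" and Z: "(ae_class M y, Z) \<in> mult_op M k"
  shows "integrable M (\<lambda>x. k x * (cmod (y x))\<^sup>2)"
    and "Re (hinner (L2 M) Z (ae_class M y)) = (\<integral>x. k x * (cmod (y x))\<^sup>2 \<partial>M)"
proof -
  obtain z where z: "z \<in> sq_integrable M" "Z = ae_class M z"
    using Z mult_op_closed[of M k] by auto
  note [measurable] = sq_integrable_measurable[OF y] sq_integrable_measurable[OF z(1)]
  have "AE x in M. z x = of_real (k x) * y x"
    using Z z y by (simp add: mult_op_iff)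
  then have ae: "AE x in M. Re (z x * cnj (y x)) = k x * (cmod (y x))\<^sup>2"
    by eventually_elim (simp add: mult.assoc complex_norm_square[symmetric] del: complex_cnj_mult)
  have int: "integrable M (\<lambda>x. z x * cnj (y x))"
    by (rule sq_integrable_inner[OF z(1) y])
  show "integrable M (\<lambda>x. k x * (cmod (y x))\<^sup>2)"
    using integrable_cong_AE[OF _ _ ae] integrable_Re[OF int] by simp
  show "Re (hinner (L2 M) Z (ae_class M y)) = (\<integral>x. k x * (cmod (y x))\<^sup>2 \<partial>M)"
    unfolding z(2) L2_inner[OF z(1) y] integral_Re[OF int, symmetric]
    by (rule integral_cong_AE[OF _ _ ae]) simp_all
qed

text \<open>Let \<open>e\<close> and \<open>e'\<close> be the images of \<open>f\<close> under
  \<open>E {0..s}\<close> and \<open>E {s<..}\<close>, so that \<open>f = e + e'\<close>. The form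
  bounds show that \<open>e\<close> vanishes where \<open>k > s^2\<close> and \<open>e'\<close>
  vanishes where \<open>k \<le> s^2\<close>, which determines \<open>e\<close>.\<close>

lemma spectral_projection_mult_op:
  assumes op: "spectral_operator (L2 M) E B" and BB: "B O B = mult_op M k"
    and k [measurable]: "k \<in> borel_measurable M" and k_nonneg: "\<And>x. 0 \<le> k x"
    and s: "0 < s" and f: "f \<in> sq_integrable M"
  shows "E {0..s} (ae_class M f) = ae_class M (\<lambda>x. indicator {..s\<^sup>2} (k x) * f x)"
proof -
  interpret spectral_operator "L2 M" E B by (rule op)
  have S: "{0..s} \<in> sets borel_nonneg" "{s<..} \<in> sets borel_nonneg"
    using s by (auto simp: sets_restrict_space_iff)
  have comm: "(E A F, E A G) \<in> mult_op M k" if "A \<in> sets borel_nonneg" "(F, G) \<in> mult_op M k" for A F G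
    using that B_E unfolding BB[symmetric] by blast
  have F: "ae_class M f \<in> hcarrier (L2 M)" using f by simp
  note proj = orth_projection_E[OF S(1)] orth_projection_E[OF S(2)]
  have c: "0 \<le> s\<^sup>2" by simp
  obtain e where e: "e \<in> sq_integrable M" "E {0..s} (ae_class M f) = ae_class M e"
    by (rule orth_projectionD[OF proj(1) f])
  obtain e' where e': "e' \<in> sq_integrable M" "E {s<..} (ae_class M f) = ae_class M e'"
    by (rule orth_projectionD[OF proj(2) f])
  have Ee: "E {0..s} (ae_class M e) = ae_class M e" "E {s<..} (ae_class M e') = ae_class M e'"
    using E_idem[OF S(1) F] E_idem[OF S(2) F] e e' by simp_all
  \<comment> \<open>The part of \<open>e\<close> on the wrong side of the cut. By
    \<open>projection_split\<close> it stays in the range of \<open>E {0..s}\<close>, so its form is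
    at most \<open>s^2\<close> times its squared norm, although \<open>k > s^2\<close> on its
    support.\<close>
  define y where "y x = indicator {s\<^sup>2<..} (k x) * e x" for x
  have y: "y \<in> sq_integrable M"
    unfolding y_def by (rule sq_integrable_indicator_mult[OF e(1), where N = borel]) simp_all
  have Ey: "E {0..s} (ae_class M y) = ae_class M y"
    unfolding y_def by (rule projection_split(2)[OF proj(1) k k_nonneg c comm[OF S(1)] e(1) Ee(1)])
  have "AE x in M. y x = 0"
  proof -
    obtain Z where Z: "(ae_class M y, Z) \<in> mult_op M k"
        "Re (hinner (L2 M) Z (ae_class M y)) \<le> s\<^sup>2 * Re (hinner (L2 M) (ae_class M y) (ae_class M y))"
      using B_square_form_le[OF _ Ey s] y unfolding BB by auto
    note form = mult_op_form[OF k y Z(1)]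
    have int: "integrable M (\<lambda>x. k x * (cmod (y x))\<^sup>2 - s\<^sup>2 * (cmod (y x))\<^sup>2)"
      using form(1) sq_integrable_integrable[OF y] by simp
    have nonneg: "0 \<le> k x * (cmod (y x))\<^sup>2 - s\<^sup>2 * (cmod (y x))\<^sup>2" for x
      by (auto simp: y_def indicator_def mult_right_mono)
    have "(\<integral>x. k x * (cmod (y x))\<^sup>2 - s\<^sup>2 * (cmod (y x))\<^sup>2 \<partial>M) \<le> 0"
      using Z(2) form sq_integrable_integrable[OF y] by (simp add: L2_norm y)
    moreover have "0 \<le> (\<integral>x. k x * (cmod (y x))\<^sup>2 - s\<^sup>2 * (cmod (y x))\<^sup>2 \<partial>M)"
      by (rule integral_nonneg_AE, rule AE_I2, rule nonneg)
    ultimately have "AE x in M. k x * (cmod (y x))\<^sup>2 - s\<^sup>2 * (cmod (y x))\<^sup>2 = 0"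
      using int nonneg by (subst integral_nonneg_eq_0_iff_AE[symmetric]) auto
    then show ?thesis
      by eventually_elim (auto simp: y_def indicator_def split: if_splits)
  qed
  then have 1: "AE x in M. s\<^sup>2 < k x \<longrightarrow> e x = 0"
    by eventually_elim (auto simp: y_def)
  define y' where "y' x = indicator {..s\<^sup>2} (k x) * e' x" for x
  have y': "y' \<in> sq_integrable M"
    unfolding y'_def by (rule sq_integrable_indicator_mult[OF e'(1), where N = borel]) simp_all
  have Ey': "E {s<..} (ae_class M y') = ae_class M y'"
    unfolding y'_def by (rule projection_split(1)[OF proj(2) k k_nonneg c comm[OF S(2)] e'(1) Ee(2)])
  have "AE x in M. y' x = 0"
  proof -
    \<comment> \<open>On the support of \<open>y'\<close> the function \<open>k\<close> is bounded
      by \<open>s^2\<close>, so \<open>y'\<close> lies in the domain of \<open>B O B\<close>, as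
      \<open>B_square_form_gt\<close> requires.\<close>
    have "(\<lambda>x. of_real (k x) * y' x) \<in> sq_integrable M"
      by (rule sq_integrable_truncate[OF k y', of "s\<^sup>2"])
        (use k_nonneg in \<open>auto simp: y'_def indicator_def split: if_splits\<close>)
    from mult_opI[OF y' this] have Z: "(ae_class M y', ae_class M (\<lambda>x. of_real (k x) * y' x)) \<in> mult_op M k" .
    note form = mult_op_form[OF k y' Z]
    have "(\<integral>x. k x * (cmod (y' x))\<^sup>2 \<partial>M) \<le> (\<integral>x. s\<^sup>2 * (cmod (y' x))\<^sup>2 \<partial>M)"
      using form(1) sq_integrable_integrable[OF y']
      by (intro integral_mono) (auto simp: y'_def indicator_def intro!: mult_right_mono)
    then have "hinner (L2 M) (ae_class M y') (ae_class M y') = 0"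
      using B_square_form_gt[OF Z[folded BB] Ey' s] form(2) by (simp add: L2_norm y')
    then show ?thesis
      using y' by (simp add: L2_norm_eq_0)
  qed
  then have 2: "AE x in M. k x \<le> s\<^sup>2 \<longrightarrow> e' x = 0"
    by eventually_elim (auto simp: y'_def)
  have "space borel_nonneg - {0..s} = {s<..}"
    using s by auto
  then have "ae_class M f = ae_class M (\<lambda>x. e x + e' x)"
    using E_split[OF S(1) F] e e' by (simp add: L2_add)
  then have "AE x in M. f x = e x + e' x"
    using f sq_integrable_add[OF e(1) e'(1)] by (simp add: ae_class_eq_iff sq_integrable_measurable)
  with 1 2 have "AE x in M. e x = indicator {..s\<^sup>2} (k x) * f x"
    by eventually_elim (auto simp: indicator_def)
  then show ?thesis
    unfolding e(2) by (rule ae_class_eqI)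
qed

lemma sets_borel_nonneg: "\<Delta> \<in> sets borel_nonneg \<Longrightarrow> \<Delta> \<in> sets borel"
  by (simp add: sets_restrict_space_iff)

section \<open>The spectral measure of a multiplication operator\<close>

context
  fixes M :: "'a measure" and r :: "'a \<Rightarrow> real"
  assumes r [measurable]: "r \<in> borel_measurable M" and r_nonneg: "\<And>x. 0 \<le> r x"
begin

text \<open>Projections act on classes, hence the detour through \<open>ae_rep\<close>;
  \<open>mult_spectral_class\<close> shows that the chosen representative does not matter.\<close>

definition mult_spectral :: "real set \<Rightarrow> ('a \<Rightarrow> complex) set \<Rightarrow> ('a \<Rightarrow> complex) set" where
  "mult_spectral \<Delta> F = ae_class M (\<lambda>x. indicator \<Delta> (r x) * ae_rep F x)"

lemma mult_spectral_class:
  assumes f: "f \<in> sq_integrable M"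
  shows "mult_spectral \<Delta> (ae_class M f) = ae_class M (\<lambda>x. indicator \<Delta> (r x) * f x)"
  unfolding mult_spectral_def
  by (rule ae_class_eqI, use ae_rep_ae_class(2)[OF sq_integrable_measurable[OF f]] in eventually_elim) simp

lemma sq_integrable_mult_spectral:
  assumes "f \<in> sq_integrable M" "\<Delta> \<in> sets borel_nonneg"
  shows "(\<lambda>x. indicator \<Delta> (r x) * f x) \<in> sq_integrable M"
  by (rule sq_integrable_indicator_mult[OF assms(1) sets_borel_nonneg[OF assms(2)] r])

lemma orth_projection_mult_spectral:
  assumes D: "\<Delta> \<in> sets borel_nonneg"
  shows "orth_projection (L2 M) (mult_spectral \<Delta>)"
proof -
  note [simp] = mult_spectral_class sq_integrable_mult_spectral[OF _ D]
  have idem: "indicator \<Delta> t * (indicator \<Delta> t * z) = indicator \<Delta> t * z" for t and z :: complex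
    by (simp add: indicator_def)
  have sym: "indicator \<Delta> t * a * cnj b = a * cnj (indicator \<Delta> t * b)" for t and a b :: complex
    by (simp add: indicator_def)
  show ?thesis
    unfolding orth_projection_def hcarrier_L2
    by (auto simp: L2_add L2_scale L2_inner sq_integrable_add sq_integrable_scale idem sym distrib_left mult.left_commute)
qed

text \<open>By disjointness the partial sums are indicators of finite unions. They converge
  pointwise to the indicator of the whole union, and \<open>norm (f x * cnj (g x))\<close> dominates
  the integrands.\<close>

lemma mult_spectral_sums:
  assumes D: "range D \<subseteq> sets borel_nonneg" "disjoint_family (D :: nat \<Rightarrow> real set)"
    and f: "f \<in> sq_integrable M" and g: "g \<in> sq_integrable M"
  shows "(\<lambda>n. hinner (L2 M) (mult_spectral (D n) (ae_class M f)) (ae_class M g)) sums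
    hinner (L2 M) (mult_spectral (\<Union>n. D n) (ae_class M f)) (ae_class M g)"
proof -
  note [measurable] = sq_integrable_measurable[OF f] sq_integrable_measurable[OF g]
  have Dn: "D n \<in> sets borel_nonneg" for n using D by auto
  have [measurable]: "D n \<in> sets borel" for n using sets_borel_nonneg[OF Dn] .
  have [measurable]: "(\<Union>n. D n) \<in> sets borel" "(\<Union>i<n. D i) \<in> sets borel" for n
    by measurable
  have U: "(\<Union>n. D n) \<in> sets borel_nonneg" using Dn by (intro sets.countable_UN) auto
  have fin: "(\<Sum>i<n. indicator (D i) t) = (indicator (\<Union>i<n. D i) t :: complex)" for n t
    using D(2) by (subst indicator_UN_disjoint) (auto simp: disjoint_family_on_def)
  have eq: "hinner (L2 M) (mult_spectral \<Delta> (ae_class M f)) (ae_class M g) =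
      (\<integral>x. indicator \<Delta> (r x) * f x * cnj (g x) \<partial>M)" if "\<Delta> \<in> sets borel_nonneg" for \<Delta>
    using f g that by (simp add: mult_spectral_class sq_integrable_mult_spectral L2_inner)
  have int: "integrable M (\<lambda>x. indicator (D n) (r x) * f x * cnj (g x))" for n
    by (intro sq_integrable_inner sq_integrable_mult_spectral f g Dn)
  have "(\<lambda>n. \<integral>x. indicator (\<Union>i<n. D i) (r x) * f x * cnj (g x) \<partial>M) \<longlonglongrightarrow>
      (\<integral>x. indicator (\<Union>n. D n) (r x) * f x * cnj (g x) \<partial>M)"
  proof (rule integral_dominated_convergence[where w = "\<lambda>x. norm (f x * cnj (g x))"])
    show "AE x in M. (\<lambda>n. indicator (\<Union>i<n. D i) (r x) * f x * cnj (g x)) \<longlonglongrightarrow> indicator (\<Union>n. D n) (r x) * f x * cnj (g x)"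
    proof (rule AE_I2)
      fix x
      have "(\<lambda>n. indicator (\<Union>i<n. D i) (r x) :: complex) \<longlonglongrightarrow> indicator (\<Union>n. D n) (r x)"
        by (rule LIMSEQ_indicator_UN)
      then show "(\<lambda>n. indicator (\<Union>i<n. D i) (r x) * f x * cnj (g x)) \<longlonglongrightarrow> indicator (\<Union>n. D n) (r x) * f x * cnj (g x)"
        by (intro tendsto_intros)
    qed
    show "integrable M (\<lambda>x. norm (f x * cnj (g x)))"
      by (intro integrable_norm sq_integrable_inner f g)
    show "AE x in M. norm (indicator (\<Union>i<n. D i) (r x) * f x * cnj (g x)) \<le> norm (f x * cnj (g x))" for n
      by (intro AE_I2) (simp add: indicator_def)
  qed simp_all
  moreover have "(\<integral>x. indicator (\<Union>i<n. D i) (r x) * f x * cnj (g x) \<partial>M) =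
      (\<Sum>i<n. \<integral>x. indicator (D i) (r x) * f x * cnj (g x) \<partial>M)" for n
    unfolding fin[symmetric] sum_distrib_right by (rule Bochner_Integration.integral_sum) (rule int)
  ultimately show ?thesis
    unfolding sums_def eq[OF U] eq[OF Dn] by simp
qed

lemma spectral_measure_mult_spectral: "spectral_measure (L2 M) borel_nonneg mult_spectral"
proof -
  have "mult_spectral {0..} (ae_class M f) = ae_class M f" if "f \<in> sq_integrable M" for f
    using that r_nonneg by (simp add: mult_spectral_class)
  then show ?thesis
    unfolding spectral_measure_def using orth_projection_mult_spectral mult_spectral_sums by auto
qed

text \<open>Describing the distribution as an image measure under \<open>r\<close> turns moments
  over the half line into integrals over \<open>M\<close>.\<close>

lemma spectral_distr_mult_spectral:
  assumes f: "f \<in> sq_integrable M"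
  shows "spectral_distr (L2 M) borel_nonneg mult_spectral (ae_class M f) =
    distr (density M (\<lambda>x. ennreal ((cmod (f x))\<^sup>2))) borel_nonneg r"
proof -
  note [measurable] = sq_integrable_measurable[OF f]
  interpret spectral_hspace "L2 M" borel_nonneg mult_spectral
    by (intro spectral_hspace.intro inner_hspace_L2 spectral_hspace_axioms.intro spectral_measure_mult_spectral)
  have [measurable]: "r \<in> measurable M borel_nonneg"
    using r_nonneg by (intro measurable_restrict_space2) auto
  show ?thesis
  proof (rule measure_eqI)
    fix A assume "A \<in> sets (\<mu> (ae_class M f))"
    then have A: "A \<in> sets borel_nonneg" by simp
    then have [measurable]: "A \<in> sets borel" by (rule sets_borel_nonneg)
    have "hinner (L2 M) (mult_spectral A (ae_class M f)) (ae_class M f) =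
        (\<integral>x. of_real (indicator A (r x) * (cmod (f x))\<^sup>2) \<partial>M)"
      using f A unfolding of_real_mult complex_norm_square
      by (simp add: mult_spectral_class L2_inner sq_integrable_mult_spectral mult.assoc of_real_indicator)
    also have "\<dots> = of_real (\<integral>x. indicator A (r x) * (cmod (f x))\<^sup>2 \<partial>M)"
      by (rule integral_complex_of_real)
    finally have "emeasure (\<mu> (ae_class M f)) A = ennreal (\<integral>x. indicator A (r x) * (cmod (f x))\<^sup>2 \<partial>M)"
      using A f by (simp add: emeasure_spectral_distr)
    also have "\<dots> = (\<integral>\<^sup>+x. ennreal (indicator A (r x) * (cmod (f x))\<^sup>2) \<partial>M)"
    proof (rule nn_integral_eq_integral[symmetric])
      show "integrable M (\<lambda>x. indicator A (r x) * (cmod (f x))\<^sup>2)"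
        by (rule Bochner_Integration.integrable_bound[OF sq_integrable_integrable[OF f]])
          (auto simp: indicator_def)
    qed simp
    also have "\<dots> = (\<integral>\<^sup>+x. ennreal ((cmod (f x))\<^sup>2) * indicator (r -` A \<inter> space M) x \<partial>M)"
      by (intro nn_integral_cong) (auto simp: indicator_def)
    also have "\<dots> = emeasure (distr (density M (\<lambda>x. ennreal ((cmod (f x))\<^sup>2))) borel_nonneg r) A"
      using A by (simp add: emeasure_distr emeasure_density)
    finally show "emeasure (\<mu> (ae_class M f)) A = \<dots>" .
  qed simp
qed

text \<open>Second moments of the image measure are integrals of \<open>r^2 |f|^2\<close> and
  describe the domain; first moments are integrals of \<open>r |f|^2\<close> and give the
  form.\<close>

lemma is_spectral_measure_of_mult_spectral:
  "is_spectral_measure_of (L2 M) (mult_op M r) mult_spectral"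
proof -
  have [measurable]: "r \<in> measurable M borel_nonneg"
    using r_nonneg by (intro measurable_restrict_space2) auto
  have meas [measurable]: "(\<lambda>t. t) \<in> borel_measurable borel_nonneg"
    by (simp add: measurable_restrict_space1)
  have sq: "(\<integral>\<^sup>+t. ennreal (t\<^sup>2) \<partial>spectral_distr (L2 M) borel_nonneg mult_spectral (ae_class M f)) < \<infinity> \<longleftrightarrow>
      (\<lambda>x. of_real (r x) * f x) \<in> sq_integrable M" if f: "f \<in> sq_integrable M" for f
  proof -
    note [measurable] = sq_integrable_measurable[OF f]
    have "(\<integral>\<^sup>+t. ennreal (t\<^sup>2) \<partial>spectral_distr (L2 M) borel_nonneg mult_spectral (ae_class M f)) =
        (\<integral>\<^sup>+x. ennreal ((cmod (f x))\<^sup>2) * ennreal ((r x)\<^sup>2) \<partial>M)"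
      by (simp add: spectral_distr_mult_spectral f nn_integral_distr nn_integral_density)
    also have "\<dots> = (\<integral>\<^sup>+x. ennreal ((cmod (of_real (r x) * f x))\<^sup>2) \<partial>M)"
      by (intro nn_integral_cong) (simp add: norm_mult power_mult_distrib ennreal_mult mult.commute)
    finally show ?thesis
      by (simp add: sq_integrable_iff_nn_integral)
  qed
  have form: "hinner (L2 M) G F = of_real (\<integral>t. t \<partial>spectral_distr (L2 M) borel_nonneg mult_spectral F)"
    if FG: "(F, G) \<in> mult_op M r" for F G
  proof -
    obtain f where f: "f \<in> sq_integrable M" "(\<lambda>x. of_real (r x) * f x) \<in> sq_integrable M"
        "F = ae_class M f" "G = ae_class M (\<lambda>x. of_real (r x) * f x)"
      by (rule mult_opE[OF FG])
    note [measurable] = sq_integrable_measurable[OF f(1)]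
    have "hinner (L2 M) G F = (\<integral>x. of_real (r x * (cmod (f x))\<^sup>2) \<partial>M)"
      unfolding of_real_mult complex_norm_square using f by (simp add: L2_inner mult.assoc)
    also have "\<dots> = of_real (\<integral>x. r x * (cmod (f x))\<^sup>2 \<partial>M)"
      by (rule integral_complex_of_real)
    also have "(\<integral>x. r x * (cmod (f x))\<^sup>2 \<partial>M) = (\<integral>t. t \<partial>spectral_distr (L2 M) borel_nonneg mult_spectral F)"
      by (simp add: f(1,3) spectral_distr_mult_spectral integral_distr integral_density mult.commute)
    finally show ?thesis .
  qed
  have "Domain (mult_op M r) = {F \<in> hcarrier (L2 M).
      (\<integral>\<^sup>+t. ennreal (t\<^sup>2) \<partial>spectral_distr (L2 M) borel_nonneg mult_spectral F) < \<infinity>}"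
  proof (intro set_eqI iffI)
    fix F assume "F \<in> Domain (mult_op M r)"
    then obtain f where "f \<in> sq_integrable M" "(\<lambda>x. of_real (r x) * f x) \<in> sq_integrable M" "F = ae_class M f"
      by (auto simp: mult_op_def)
    then show "F \<in> {F \<in> hcarrier (L2 M).
        (\<integral>\<^sup>+t. ennreal (t\<^sup>2) \<partial>spectral_distr (L2 M) borel_nonneg mult_spectral F) < \<infinity>}"
      using sq by auto
  next
    fix F assume "F \<in> {F \<in> hcarrier (L2 M).
        (\<integral>\<^sup>+t. ennreal (t\<^sup>2) \<partial>spectral_distr (L2 M) borel_nonneg mult_spectral F) < \<infinity>}"
    then obtain f where f: "f \<in> sq_integrable M" "(\<lambda>x. of_real (r x) * f x) \<in> sq_integrable M" "F = ae_class M f"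
      using sq by auto
    then show "F \<in> Domain (mult_op M r)"
      using mult_opI[OF f(1,2)] by blast
  qed
  then show ?thesis
    unfolding is_spectral_measure_of_def using spectral_measure_mult_spectral form by auto
qed

end

section \<open>Composition operators\<close>

locale composition_operator = sigma_finite_measure M for M :: "'a measure" +
  fixes \<phi> :: "'a \<Rightarrow> 'a"
  assumes nonsingular: "nonsingular M \<phi>"
    and dense: "densely_defined (L2 M) (comp_op M \<phi>)"
begin

abbreviation h :: "'a \<Rightarrow> ennreal" where "h \<equiv> h_deriv M \<phi>"

text \<open>Real-valued version of \<open>h\<close>. \<open>enn2real\<close> sends infinity to 0,
  which changes \<open>h\<close> only on a null set, by \<open>AE_h_finite\<close>.\<close>

definition k :: "'a \<Rightarrow> real" where "k x = enn2real (h x)"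

section \<open>The Radon-Nikodym derivative and change of variables\<close>

lemma measurable_phi [measurable]: "\<phi> \<in> measurable M M"
  using nonsingular by (simp add: nonsingular_def)

lemma measurable_h [measurable]: "h \<in> borel_measurable M"
  by (rule h_deriv(1)[OF sigma_finite_measure_axioms nonsingular])

lemma measurable_k [measurable]: "k \<in> borel_measurable M"
  unfolding k_def by measurable

lemma k_nonneg [simp]: "0 \<le> k x"
  by (simp add: k_def)

lemma density_h: "distr M M \<phi> = density M h"
  using nonsingular by (simp add: h_deriv_def nonsingular_def density_RN_deriv)

text \<open>Nonsingularity in the form in which it is used: preimages of null sets under
  \<open>\<phi>\<close> are null.\<close>

lemma AE_comp: "AE x in M. P x \<Longrightarrow> AE x in M. P (\<phi> x)"
  using nonsingular absolutely_continuous_AE[of "distr M M \<phi>" M P]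
  by (intro AE_distrD[OF measurable_phi]) (simp_all add: nonsingular_def)

lemma nn_integral_comp_h:
  assumes [measurable]: "f \<in> borel_measurable M"
  shows "(\<integral>\<^sup>+x. f (\<phi> x) \<partial>M) = (\<integral>\<^sup>+x. h x * f x \<partial>M)"
  using nn_integral_distr[OF measurable_phi, of f] by (simp add: density_h nn_integral_density)

text \<open>Every \<open>f\<close> in the domain makes \<open>h |f|^2\<close> integrable, so it
  vanishes almost everywhere on a set \<open>D\<close> where \<open>h\<close> is infinite. If
  \<open>D\<close> had finite positive measure, \<open>indicator D\<close> would keep distance at
  least \<open>sqrt (measure M D)\<close> from the domain, against density.\<close>

lemma AE_h_finite: "AE x in M. h x < \<infinity>"
proof -
  obtain S :: "nat \<Rightarrow> 'a set" where S: "range S \<subseteq> sets M" "(\<Union>i. S i) = space M" "\<And>i. emeasure M (S i) \<noteq> \<infinity>"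
    using sigma_finite by metis
  have "AE x in M. x \<in> S i \<longrightarrow> h x < \<infinity>" for i
  proof (rule ccontr)
    define D where "D = {x\<in>space M. h x = \<infinity> \<and> x \<in> S i}"
    have [measurable]: "S i \<in> sets M" using S(1) by auto
    have D [measurable]: "D \<in> sets M"
      unfolding D_def by measurable
    have "emeasure M D \<le> emeasure M (S i)"
      by (intro emeasure_mono) (auto simp: D_def)
    then have Dfin: "emeasure M D < \<infinity>"
      using S(3)[of i] by (simp add: top.not_eq_extremum)
    assume "\<not> (AE x in M. x \<in> S i \<longrightarrow> h x < \<infinity>)"
    moreover have eq: "{x \<in> space M. \<not> (x \<in> S i \<longrightarrow> h x < \<infinity>)} = D"
      by (auto simp: D_def less_top[symmetric])
    ultimately have "emeasure M D \<noteq> 0"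
      using AE_iff_measurable[OF D eq] by simp
    then have pos: "0 < measure M D"
      using Dfin by (simp add: measure_def enn2real_positive_iff zero_less_iff_neq_zero)
    have ind: "(indicator D :: 'a \<Rightarrow> complex) \<in> sq_integrable M"
      by (rule sq_integrable_indicator[OF D Dfin])
    have "\<exists>F\<in>Domain (comp_op M \<phi>). hdist (L2 M) (ae_class M (indicator D)) F < sqrt (measure M D)"
      using dense[unfolded densely_defined_def, rule_format, of "ae_class M (indicator D)" "sqrt (measure M D)"]
        ind pos by simp
    then obtain F where F: "F \<in> Domain (comp_op M \<phi>)"
        "hdist (L2 M) (ae_class M (indicator D)) F < sqrt (measure M D)"
      by blast
    obtain f where f: "f \<in> sq_integrable M" "f \<circ> \<phi> \<in> sq_integrable M" "F = ae_class M f"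
      using F(1) by (auto simp: comp_op_def)
    note [measurable] = sq_integrable_measurable[OF f(1)]
    have "(\<integral>\<^sup>+x. h x * ennreal ((cmod (f x))\<^sup>2) \<partial>M) = (\<integral>\<^sup>+x. ennreal ((cmod (f (\<phi> x)))\<^sup>2) \<partial>M)"
      by (simp add: nn_integral_comp_h[symmetric])
    also have "\<dots> < \<infinity>"
      using f(2) sq_integrable_iff_nn_integral[OF sq_integrable_measurable[OF f(2)]] by simp
    finally have "AE x in M. h x * ennreal ((cmod (f x))\<^sup>2) \<noteq> \<infinity>"
      by (intro nn_integral_PInf_AE) auto
    then have ae: "AE x in M. indicator D x \<le> (cmod (indicator D x - f x))\<^sup>2"
      by eventually_elim (auto simp: D_def indicator_def ennreal_mult_eq_top_iff)
    have "measure M D = (\<integral>x. indicator D x \<partial>M)"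
      by simp
    also have "\<dots> \<le> (\<integral>x. (cmod (indicator D x - f x))\<^sup>2 \<partial>M)"
      using Dfin ae sq_integrable_integrable[OF sq_integrable_diff[OF ind f(1)]]
      by (intro integral_mono_AE) auto
    finally have "sqrt (measure M D) \<le> hdist (L2 M) (ae_class M (indicator D)) F"
      using f ind by (simp add: hdist_L2)
    with F(2) show False by simp
  qed
  then have "AE x in M. \<forall>i. x \<in> S i \<longrightarrow> h x < \<infinity>"
    unfolding AE_all_countable by blast
  then show ?thesis
    using AE_space by eventually_elim (use S(2) in blast)
qed

lemma AE_h_k: "AE x in M. h x = ennreal (k x)"
  using AE_h_finite by eventually_elim (simp add: k_def)

lemma distr_phi: "distr M M \<phi> = density M (\<lambda>x. ennreal (k x))"
  unfolding density_h using AE_h_k by (intro density_cong) auto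

lemma nn_integral_comp:
  assumes [measurable]: "f \<in> borel_measurable M"
  shows "(\<integral>\<^sup>+x. f (\<phi> x) \<partial>M) = (\<integral>\<^sup>+x. ennreal (k x) * f x \<partial>M)"
  using nn_integral_distr[OF measurable_phi, of f] by (simp add: distr_phi nn_integral_density)

lemma integral_comp:
  fixes f :: "'a \<Rightarrow> complex"
  assumes [measurable]: "f \<in> borel_measurable M"
  shows "(\<integral>x. f (\<phi> x) \<partial>M) = (\<integral>x. of_real (k x) * f x \<partial>M)"
  using Bochner_Integration.integral_distr[OF measurable_phi, of f]
  by (simp add: distr_phi integral_density scaleR_conv_of_real)

lemma measurable_comp_phi: "f \<in> sq_integrable M \<Longrightarrow> f \<circ> \<phi> \<in> borel_measurable M"
  by (rule measurable_comp[OF measurable_phi sq_integrable_measurable])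

lemma sq_integrable_comp_iff:
  assumes f: "f \<in> sq_integrable M"
  shows "f \<circ> \<phi> \<in> sq_integrable M \<longleftrightarrow> integrable M (\<lambda>x. k x * (cmod (f x))\<^sup>2)"
proof -
  note [measurable] = sq_integrable_measurable[OF f]
  have "(\<integral>\<^sup>+x. ennreal ((cmod ((f \<circ> \<phi>) x))\<^sup>2) \<partial>M) = (\<integral>\<^sup>+x. ennreal (k x * (cmod (f x))\<^sup>2) \<partial>M)"
    using nn_integral_comp[of "\<lambda>x. ennreal ((cmod (f x))\<^sup>2)"] by (simp add: ennreal_mult')
  then show ?thesis
    unfolding sq_integrable_iff_nn_integral[OF measurable_comp_phi[OF f]]
    by (simp add: integrable_iff_bounded)
qed

text \<open>Supplies enough elements of the domain to test with: functions living where
  \<open>k\<close> is bounded.\<close>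

lemma sq_integrable_comp_truncate:
  assumes f: "f \<in> sq_integrable M" and supp: "\<And>x. f x \<noteq> 0 \<Longrightarrow> k x \<le> c"
  shows "f \<circ> \<phi> \<in> sq_integrable M"
proof -
  note [measurable] = sq_integrable_measurable[OF f]
  have "integrable M (\<lambda>x. k x * (cmod (f x))\<^sup>2)"
  proof (rule Bochner_Integration.integrable_bound)
    show "integrable M (\<lambda>x. c * (cmod (f x))\<^sup>2)"
      using sq_integrable_integrable[OF f] by simp
    have "k x * (cmod (f x))\<^sup>2 \<le> \<bar>c\<bar> * (cmod (f x))\<^sup>2" for x
      using supp[of x] by (cases "f x = 0") (auto intro!: mult_right_mono)
    then show "AE x in M. norm (k x * (cmod (f x))\<^sup>2) \<le> norm (c * (cmod (f x))\<^sup>2)"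
      by (simp add: abs_mult)
  qed simp
  then show ?thesis
    using f by (simp add: sq_integrable_comp_iff)
qed

section \<open>The composition operator is linear and closed\<close>

lemma comp_opI:
  "f \<in> sq_integrable M \<Longrightarrow> f \<circ> \<phi> \<in> sq_integrable M \<Longrightarrow> (ae_class M f, ae_class M (f \<circ> \<phi>)) \<in> comp_op M \<phi>"
  by (auto simp: comp_op_def)

lemma comp_opE:
  assumes "(F, G) \<in> comp_op M \<phi>"
  obtains f where "f \<in> sq_integrable M" "f \<circ> \<phi> \<in> sq_integrable M" "F = ae_class M f" "G = ae_class M (f \<circ> \<phi>)"
  using assms by (auto simp: comp_op_def)

lemma comp_op_iff:
  assumes f: "f \<in> sq_integrable M" and g: "g \<in> sq_integrable M"
  shows "(ae_class M f, ae_class M g) \<in> comp_op M \<phi> \<longleftrightarrow> (AE x in M. g x = f (\<phi> x))"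
proof
  assume "(ae_class M f, ae_class M g) \<in> comp_op M \<phi>"
  then obtain f' where f': "f' \<in> sq_integrable M" "f' \<circ> \<phi> \<in> sq_integrable M"
      "ae_class M f = ae_class M f'" "ae_class M g = ae_class M (f' \<circ> \<phi>)"
    by (rule comp_opE)
  have "AE x in M. f x = f' x" "AE x in M. g x = f' (\<phi> x)"
    using f'(3,4) f g f'(1,2) by (simp_all add: ae_class_eq_iff sq_integrable_measurable)
  then show "AE x in M. g x = f (\<phi> x)"
    using AE_comp[of "\<lambda>x. f x = f' x"] by (auto elim: AE_mp)
next
  assume "AE x in M. g x = f (\<phi> x)"
  then have eq: "AE x in M. (f \<circ> \<phi>) x = g x"
    by eventually_elim simp
  from comp_opI[OF f sq_integrable_cong_AE[OF g measurable_comp_phi[OF f] eq]]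
  show "(ae_class M f, ae_class M g) \<in> comp_op M \<phi>"
    using ae_class_eqI[OF eq] by simp
qed

lemma comp_op_closed: "comp_op M \<phi> \<subseteq> hcarrier (L2 M) \<times> hcarrier (L2 M)"
  by (auto simp: comp_op_def)

lemma single_valued_comp_op: "single_valued (comp_op M \<phi>)"
proof (rule single_valuedI)
  fix F G K assume FG: "(F, G) \<in> comp_op M \<phi>" and FK: "(F, K) \<in> comp_op M \<phi>"
  obtain f where f: "f \<in> sq_integrable M" "f \<circ> \<phi> \<in> sq_integrable M" "F = ae_class M f" "G = ae_class M (f \<circ> \<phi>)"
    by (rule comp_opE[OF FG])
  obtain u where u: "u \<in> sq_integrable M" "K = ae_class M u"
    using FK comp_op_closed by auto
  have "AE x in M. u x = f (\<phi> x)"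
    using FK f u by (simp add: comp_op_iff)
  then have "AE x in M. (f \<circ> \<phi>) x = u x"
    by eventually_elim simp
  then show "G = K"
    unfolding f(4) u(2) by (rule ae_class_eqI)
qed

lemma linear_op_comp_op: "linear_op (L2 M) (comp_op M \<phi>)"
proof -
  have "(\<lambda>_. 0) \<in> sq_integrable M"
    by (simp add: sq_integrable_def)
  then have ne: "comp_op M \<phi> \<noteq> {}"
    using comp_opI[of "\<lambda>_. 0"] by (auto simp: o_def)
  have add: "(hadd (L2 M) F F', hadd (L2 M) G G') \<in> comp_op M \<phi>"
    if FG: "(F, G) \<in> comp_op M \<phi>" "(F', G') \<in> comp_op M \<phi>" for F G F' G'
  proof -
    obtain f where f: "f \<in> sq_integrable M" "f \<circ> \<phi> \<in> sq_integrable M"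
        "F = ae_class M f" "G = ae_class M (f \<circ> \<phi>)"
      by (rule comp_opE[OF FG(1)])
    obtain f' where f': "f' \<in> sq_integrable M" "f' \<circ> \<phi> \<in> sq_integrable M"
        "F' = ae_class M f'" "G' = ae_class M (f' \<circ> \<phi>)"
      by (rule comp_opE[OF FG(2)])
    show ?thesis
      unfolding f(3,4) f'(3,4) L2_add[OF f(1) f'(1)] L2_add[OF f(2) f'(2)]
      using sq_integrable_add[OF f(1) f'(1)] sq_integrable_add[OF f(2) f'(2)]
      by (subst comp_op_iff) auto
  qed
  have scale: "(hscale (L2 M) c F, hscale (L2 M) c G) \<in> comp_op M \<phi>"
    if FG: "(F, G) \<in> comp_op M \<phi>" for c F G
  proof -
    obtain f where f: "f \<in> sq_integrable M" "f \<circ> \<phi> \<in> sq_integrable M"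
        "F = ae_class M f" "G = ae_class M (f \<circ> \<phi>)"
      by (rule comp_opE[OF FG])
    show ?thesis
      unfolding f(3,4) L2_scale[OF f(1)] L2_scale[OF f(2)]
      using sq_integrable_scale[OF f(1)] sq_integrable_scale[OF f(2)]
      by (subst comp_op_iff) auto
  qed
  show ?thesis
    unfolding linear_op_def using comp_op_closed ne single_valued_comp_op add scale by auto
qed

text \<open>Square integrability of \<open>f \<circ> \<phi>\<close> is not known in advance, so
  \<open>f \<circ> \<phi>\<close> and \<open>g\<close> are compared where
  \<open>k \<circ> \<phi> \<le> m\<close>. There their squared distance is at most
  \<open>2 m |u n - f|^2 + 2 |u n \<circ> \<phi> - g|^2\<close>, in norms, which tends to 0; the
  sets for all \<open>m\<close> cover the space.\<close>

lemma closed_op_comp_op: "closed_op (L2 M) (comp_op M \<phi>)"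
  unfolding closed_op_def
proof (intro allI ballI impI, elim conjE)
  fix U V :: "nat \<Rightarrow> ('a \<Rightarrow> complex) set" and F G
  assume "F \<in> hcarrier (L2 M)" "G \<in> hcarrier (L2 M)" and UV: "\<forall>n. (U n, V n) \<in> comp_op M \<phi>"
    and limU: "(\<lambda>n. hdist (L2 M) (U n) F) \<longlonglongrightarrow> 0" and limV: "(\<lambda>n. hdist (L2 M) (V n) G) \<longlonglongrightarrow> 0"
  then obtain f g where f: "f \<in> sq_integrable M" "F = ae_class M f" and g: "g \<in> sq_integrable M" "G = ae_class M g"
    by auto
  have "\<forall>n. \<exists>u. u \<in> sq_integrable M \<and> u \<circ> \<phi> \<in> sq_integrable M \<and> U n = ae_class M u \<and> V n = ae_class M (u \<circ> \<phi>)"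
    using UV unfolding comp_op_def by blast
  then obtain u where u: "\<And>n. u n \<in> sq_integrable M" "\<And>n. u n \<circ> \<phi> \<in> sq_integrable M"
      "\<And>n. U n = ae_class M (u n)" "\<And>n. V n = ae_class M (u n \<circ> \<phi>)"
    by metis
  note [measurable] = sq_integrable_measurable[OF f(1)] sq_integrable_measurable[OF g(1)] sq_integrable_measurable[OF u(1)]
  have "AE x in M. k (\<phi> x) \<le> real m \<longrightarrow> g x = f (\<phi> x)" for m
  proof -
    define I :: "'a \<Rightarrow> ennreal" where "I x = indicator {..real m} (k x)" for x
    have [measurable]: "I \<in> borel_measurable M"
      unfolding I_def by measurable
    define J where "J = (\<integral>\<^sup>+x. I (\<phi> x) * ennreal ((cmod (f (\<phi> x) - g x))\<^sup>2) \<partial>M)"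
    define B where "B n = 2 * (real m * (hdist (L2 M) (U n) F)\<^sup>2) + 2 * (hdist (L2 M) (V n) G)\<^sup>2" for n
    have "J \<le> ennreal (B n)" for n
    proof -
      have "J \<le> (\<integral>\<^sup>+x. 2 * (I (\<phi> x) * ennreal ((cmod (u n (\<phi> x) - f (\<phi> x)))\<^sup>2)) + 2 * ennreal ((cmod ((u n \<circ> \<phi>) x - g x))\<^sup>2) \<partial>M)"
        unfolding J_def
      proof (intro nn_integral_mono)
        fix x
        define a b where "a = u n (\<phi> x) - f (\<phi> x)" and "b = u n (\<phi> x) - g x"
        have "(cmod (b - a))\<^sup>2 \<le> (cmod b + cmod a)\<^sup>2"
          by (intro power_mono norm_triangle_ineq4) simp
        also have "\<dots> \<le> 2 * (cmod a)\<^sup>2 + 2 * (cmod b)\<^sup>2"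
          using sum_squares_bound[of "cmod b" "cmod a"] by (simp add: power2_sum)
        finally have "ennreal ((cmod (b - a))\<^sup>2) \<le> ennreal (2 * (cmod a)\<^sup>2 + 2 * (cmod b)\<^sup>2)"
          by (rule ennreal_leI)
        also have "\<dots> = 2 * ennreal ((cmod a)\<^sup>2) + 2 * ennreal ((cmod b)\<^sup>2)"
          by (simp add: ennreal_plus ennreal_mult)
        finally show "I (\<phi> x) * ennreal ((cmod (f (\<phi> x) - g x))\<^sup>2) \<le>
            2 * (I (\<phi> x) * ennreal ((cmod (u n (\<phi> x) - f (\<phi> x)))\<^sup>2)) + 2 * ennreal ((cmod ((u n \<circ> \<phi>) x - g x))\<^sup>2)"
          by (simp add: a_def b_def I_def indicator_def)
      qed
      also have "\<dots> = 2 * (\<integral>\<^sup>+x. I (\<phi> x) * ennreal ((cmod (u n (\<phi> x) - f (\<phi> x)))\<^sup>2) \<partial>M) +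
          2 * (\<integral>\<^sup>+x. ennreal ((cmod ((u n \<circ> \<phi>) x - g x))\<^sup>2) \<partial>M)"
        by (simp add: nn_integral_add nn_integral_cmult)
      \<comment> \<open>The change of variables turns the truncation at \<open>\<phi> x\<close> into
        \<open>k x \<le> m\<close>, so the weight \<open>k\<close> that it produces is bounded by
        \<open>m\<close>.\<close>
      also have "(\<integral>\<^sup>+x. I (\<phi> x) * ennreal ((cmod (u n (\<phi> x) - f (\<phi> x)))\<^sup>2) \<partial>M) =
          (\<integral>\<^sup>+x. ennreal (k x) * (I x * ennreal ((cmod (u n x - f x))\<^sup>2)) \<partial>M)"
        by (rule nn_integral_comp) measurable
      also have "\<dots> \<le> (\<integral>\<^sup>+x. ennreal (real m) * ennreal ((cmod (u n x - f x))\<^sup>2) \<partial>M)"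
        by (intro nn_integral_mono) (auto simp: I_def indicator_def intro!: mult_right_mono ennreal_leI)
      also have "\<dots> = ennreal (real m) * ennreal ((hdist (L2 M) (U n) F)\<^sup>2)"
        by (subst nn_integral_cmult) (simp_all add: nn_integral_hdist_L2 u f)
      also have "(\<integral>\<^sup>+x. ennreal ((cmod ((u n \<circ> \<phi>) x - g x))\<^sup>2) \<partial>M) = ennreal ((hdist (L2 M) (V n) G)\<^sup>2)"
        unfolding u(4) g(2) by (rule nn_integral_hdist_L2[OF u(2) g(1)])
      finally show ?thesis
        by (simp add: B_def ennreal_plus ennreal_mult add_mono mult_left_mono)
    qed
    moreover have "(\<lambda>n. ennreal (B n)) \<longlonglongrightarrow> ennreal (2 * (real m * 0\<^sup>2) + 2 * 0\<^sup>2)"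
      unfolding B_def by (intro tendsto_ennrealI tendsto_intros limU limV)
    ultimately have "J \<le> 0"
      by (intro LIMSEQ_le_const) (auto simp: tendsto_ennrealI)
    then have "AE x in M. I (\<phi> x) * ennreal ((cmod (f (\<phi> x) - g x))\<^sup>2) = 0"
      unfolding J_def by (subst nn_integral_0_iff_AE[symmetric]) auto
    then show ?thesis
      by eventually_elim (auto simp: I_def)
  qed
  then have "AE x in M. \<forall>m. k (\<phi> x) \<le> real m \<longrightarrow> g x = f (\<phi> x)"
    unfolding AE_all_countable by blast
  then have "AE x in M. g x = f (\<phi> x)"
    by eventually_elim (meson real_arch_simple)
  then show "(F, G) \<in> comp_op M \<phi>"
    using f g by (simp add: comp_op_iff)
qed

section \<open>The composition operator followed by its adjoint\<close>

lemma inner_comp: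
  assumes f: "f \<in> sq_integrable M" and g: "g \<in> sq_integrable M"
  shows "(\<integral>x. (f \<circ> \<phi>) x * cnj ((g \<circ> \<phi>) x) \<partial>M) = (\<integral>x. of_real (k x) * f x * cnj (g x) \<partial>M)"
proof -
  note [measurable] = sq_integrable_measurable[OF f] sq_integrable_measurable[OF g]
  show ?thesis
    using integral_comp[of "\<lambda>x. f x * cnj (g x)"] by (simp add: mult.assoc)
qed

text \<open>\<open>inner_comp\<close> is the weak form of this identity. The inclusion into
  \<open>mult_op M k\<close> follows from \<open>mult_op_test\<close>, since functions living where
  \<open>k\<close> is bounded belong to the domain of \<open>comp_op M \<phi>\<close>; the other
  inclusion is mainly a question of domains.\<close>

lemma comp_op_O_adjoint: "comp_op M \<phi> O adjoint_op (L2 M) (comp_op M \<phi>) = mult_op M k"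
proof (intro set_eqI iffI; clarify)
  fix F G K assume FG: "(F, G) \<in> comp_op M \<phi>" and GK: "(G, K) \<in> adjoint_op (L2 M) (comp_op M \<phi>)"
  obtain f where f: "f \<in> sq_integrable M" "f \<circ> \<phi> \<in> sq_integrable M" "F = ae_class M f" "G = ae_class M (f \<circ> \<phi>)"
    by (rule comp_opE[OF FG])
  obtain l where l: "l \<in> sq_integrable M" "K = ae_class M l"
    using GK by (auto simp: adjoint_op_def)
  have "AE x in M. l x = of_real (k x) * f x"
  proof (rule mult_op_test[OF measurable_k f(1) l(1)])
    fix u n assume u: "u \<in> sq_integrable M" and supp: "\<And>x. u x \<noteq> 0 \<Longrightarrow> \<bar>k x\<bar> \<le> real n"
    have uc: "u \<circ> \<phi> \<in> sq_integrable M"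
      by (rule sq_integrable_comp_truncate[OF u, of "real n"]) (use supp in simp)
    have "hinner (L2 M) (ae_class M (u \<circ> \<phi>)) G = hinner (L2 M) (ae_class M u) K"
      using GK comp_opI[OF u uc] by (auto simp: adjoint_op_def)
    then have "(\<integral>x. (u \<circ> \<phi>) x * cnj ((f \<circ> \<phi>) x) \<partial>M) = (\<integral>x. u x * cnj (l x) \<partial>M)"
      unfolding f(4) l(2) L2_inner[OF uc f(2)] L2_inner[OF u l(1)] .
    then show "(\<integral>x. of_real (k x) * u x * cnj (f x) \<partial>M) = (\<integral>x. u x * cnj (l x) \<partial>M)"
      unfolding inner_comp[OF u f(1)] .
  qed
  then show "(F, K) \<in> mult_op M k"
    using f l by (simp add: mult_op_iff)
next
  fix F K assume FK: "(F, K) \<in> mult_op M k"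
  obtain f where f: "f \<in> sq_integrable M" "(\<lambda>x. of_real (k x) * f x) \<in> sq_integrable M"
      "F = ae_class M f" "K = ae_class M (\<lambda>x. of_real (k x) * f x)"
    by (rule mult_opE[OF FK])
  \<comment> \<open>Integrability of \<open>k f * cnj f\<close> is integrability of
    \<open>k |f|^2\<close>, the criterion for \<open>f\<close> to lie in the domain of the
    composition operator.\<close>
  have "integrable M (\<lambda>x. norm (of_real (k x) * f x * cnj (f x)))"
    by (intro integrable_norm sq_integrable_inner f)
  also have "(\<lambda>x. norm (of_real (k x) * f x * cnj (f x))) = (\<lambda>x. k x * (cmod (f x))\<^sup>2)"
    by (simp add: fun_eq_iff norm_mult power2_eq_square)
  finally have fc: "f \<circ> \<phi> \<in> sq_integrable M"
    by (simp add: sq_integrable_comp_iff f)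
  have "hinner (L2 M) U' (ae_class M (f \<circ> \<phi>)) = hinner (L2 M) U K" if UU': "(U, U') \<in> comp_op M \<phi>" for U U'
  proof -
    obtain u where u: "u \<in> sq_integrable M" "u \<circ> \<phi> \<in> sq_integrable M" "U = ae_class M u" "U' = ae_class M (u \<circ> \<phi>)"
      by (rule comp_opE[OF UU'])
    show ?thesis
      unfolding u(3,4) f(4) L2_inner[OF u(2) fc] L2_inner[OF u(1) f(2)] inner_comp[OF u(1) f(1)]
      by (simp add: mult_ac)
  qed
  then have "(ae_class M (f \<circ> \<phi>), K) \<in> adjoint_op (L2 M) (comp_op M \<phi>)"
    using f fc by (auto simp: adjoint_op_def)
  with comp_opI[OF f(1) fc] f(3) show "(F, K) \<in> comp_op M \<phi> O adjoint_op (L2 M) (comp_op M \<phi>)"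
    by blast
qed

section \<open>Quasinormality and invariance of the derivative\<close>

lemma AE_h_iff_k: "(AE x in M. h x = h (\<phi> x)) \<longleftrightarrow> (AE x in M. k x = k (\<phi> x))"
proof
  assume "AE x in M. h x = h (\<phi> x)"
  then show "AE x in M. k x = k (\<phi> x)"
    by eventually_elim (simp add: k_def)
next
  assume "AE x in M. k x = k (\<phi> x)"
  with AE_h_k AE_comp[OF AE_h_k] show "AE x in M. h x = h (\<phi> x)"
    by eventually_elim simp
qed

lemma quasinormal_imp_AE_k:
  assumes "quasinormal (L2 M) (comp_op M \<phi>)"
  shows "AE x in M. k x = k (\<phi> x)"
proof -
  obtain B E where mod: "is_modulus (L2 M) (comp_op M \<phi>) B" and E: "is_spectral_measure_of (L2 M) B E"
    and comm: "\<And>\<Delta>. \<Delta> \<in> sets borel_nonneg \<Longrightarrow>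
      comp_op M \<phi> O graph_on (L2 M) (E \<Delta>) \<subseteq> graph_on (L2 M) (E \<Delta>) O comp_op M \<phi>"
    using assms by (auto simp: quasinormal_def)
  have op: "spectral_operator (L2 M) E B"
    using mod E by (intro spectral_operator.intro spectral_hspace.intro inner_hspace_L2
      spectral_hspace_axioms.intro spectral_operator_axioms.intro)
      (simp_all add: is_modulus_def is_spectral_measure_of_def)
  have BB: "B O B = mult_op M k"
    using mod comp_op_O_adjoint by (simp add: is_modulus_def)
  note E_mult = spectral_projection_mult_op[OF op BB measurable_k k_nonneg]
  \<comment> \<open>Projecting after composition multiplies \<open>f \<circ> \<phi>\<close> by the
    indicator of \<open>k x \<le> s^2\<close>; projecting before it multiplies by the indicator of
    \<open>k (\<phi> x) \<le> s^2\<close>. Commutation equates the products, so the indicators agree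
    where \<open>f \<circ> \<phi>\<close> is nonzero.\<close>
  have *: "AE x in M. f (\<phi> x) \<noteq> 0 \<longrightarrow> (k x \<le> s\<^sup>2 \<longleftrightarrow> k (\<phi> x) \<le> s\<^sup>2)"
    if s: "0 < s" and f: "f \<in> sq_integrable M" and fc: "f \<circ> \<phi> \<in> sq_integrable M" for s f
  proof -
    have S: "{0..s} \<in> sets borel_nonneg"
      by (auto simp: sets_restrict_space_iff)
    define u where "u x = indicator {..s\<^sup>2} (k x) * f x" for x
    define v where "v x = indicator {..s\<^sup>2} (k x) * (f \<circ> \<phi>) x" for x
    have u: "u \<in> sq_integrable M"
      unfolding u_def by (rule sq_integrable_indicator_mult[OF f, where N = borel]) simp_all
    have v: "v \<in> sq_integrable M"
      unfolding v_def by (rule sq_integrable_indicator_mult[OF fc, where N = borel]) simp_all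
    have "(ae_class M f, E {0..s} (ae_class M (f \<circ> \<phi>))) \<in> comp_op M \<phi> O graph_on (L2 M) (E {0..s})"
      using comp_opI[OF f fc] fc by (auto simp: graph_on_def)
    with comm[OF S] have "(ae_class M f, ae_class M v) \<in> graph_on (L2 M) (E {0..s}) O comp_op M \<phi>"
      unfolding v_def[abs_def] E_mult[OF s fc, symmetric] by blast
    then have "(E {0..s} (ae_class M f), ae_class M v) \<in> comp_op M \<phi>"
      by (auto simp: graph_on_def)
    then have "(ae_class M u, ae_class M v) \<in> comp_op M \<phi>"
      by (simp add: E_mult[OF s f] u_def[abs_def])
    then have "AE x in M. v x = u (\<phi> x)"
      using u v by (simp add: comp_op_iff)
    then show ?thesis
      by eventually_elim (auto simp: u_def v_def indicator_def split: if_splits)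
  qed
  obtain S :: "nat \<Rightarrow> 'a set" where S: "range S \<subseteq> sets M" "(\<Union>i. S i) = space M" "\<And>i. emeasure M (S i) \<noteq> \<infinity>"
    using sigma_finite by metis
  \<comment> \<open>The test functions are indicators of \<open>{k \<le> m} \<inter> S i\<close>:
    finite measure makes them square integrable, bounded \<open>k\<close> puts them in the domain.
    There are countably many triples \<open>m\<close>, \<open>i\<close>, \<open>q\<close>, so one
    null set serves for all.\<close>
  have "AE x in M. k (\<phi> x) \<le> real m \<and> \<phi> x \<in> S i \<and> 0 < q \<longrightarrow> (k x \<le> (of_rat q)\<^sup>2 \<longleftrightarrow> k (\<phi> x) \<le> (of_rat q)\<^sup>2)" for m i and q :: rat
  proof (cases "0 < q")
    case True
    define A where "A = {x \<in> space M. k x \<le> real m \<and> x \<in> S i}"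
    have [measurable]: "S i \<in> sets M" using S(1) by auto
    have A: "A \<in> sets M"
      unfolding A_def by measurable
    have "emeasure M A \<le> emeasure M (S i)"
      by (intro emeasure_mono) (auto simp: A_def)
    then have f: "(indicator A :: 'a \<Rightarrow> complex) \<in> sq_integrable M"
      using S(3)[of i] by (intro sq_integrable_indicator A) (simp add: order.strict_trans1 top.not_eq_extremum)
    have "indicator A \<circ> \<phi> \<in> sq_integrable M"
      by (rule sq_integrable_comp_truncate[OF f, of "real m"]) (auto simp: A_def indicator_def split: if_splits)
    from *[OF _ f this, of "of_rat q"] True
    have "AE x in M. indicator A (\<phi> x) \<noteq> (0::complex) \<longrightarrow> (k x \<le> (of_rat q)\<^sup>2 \<longleftrightarrow> k (\<phi> x) \<le> (of_rat q)\<^sup>2)"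
      by simp
    moreover have "AE x in M. \<phi> x \<in> space M"
      using measurable_space[OF measurable_phi] by simp
    ultimately show ?thesis
      by eventually_elim (auto simp: A_def)
  qed simp
  then have "AE x in M. \<forall>m i. \<forall>q::rat. k (\<phi> x) \<le> real m \<and> \<phi> x \<in> S i \<and> 0 < q \<longrightarrow> (k x \<le> (of_rat q)\<^sup>2 \<longleftrightarrow> k (\<phi> x) \<le> (of_rat q)\<^sup>2)"
    unfolding AE_all_countable by blast
  moreover have "AE x in M. \<phi> x \<in> space M"
    using measurable_space[OF measurable_phi] by simp
  ultimately show ?thesis
  proof eventually_elim
    case (elim x)
    obtain m where "k (\<phi> x) \<le> real m" using real_arch_simple by blast
    moreover obtain i where "\<phi> x \<in> S i" using S(2) elim(2) by blast
    ultimately have iff: "k x \<le> (of_rat q)\<^sup>2 \<longleftrightarrow> k (\<phi> x) \<le> (of_rat q)\<^sup>2" if "0 < q" for q :: rat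
      using elim(1) that by blast
    \<comment> \<open>Distinct nonnegative reals are separated by the square of a positive rational,
      chosen between their square roots.\<close>
    have False if ab: "a < b" "0 \<le> a" and sep: "\<And>q::rat. 0 < q \<Longrightarrow> a \<le> (of_rat q)\<^sup>2 \<longleftrightarrow> b \<le> (of_rat q)\<^sup>2" for a b :: real
    proof -
      obtain q where q: "sqrt a < of_rat q" "of_rat q < sqrt b"
        using of_rat_dense[of "sqrt a" "sqrt b"] ab by auto
      then have pos: "0 < (of_rat q :: real)"
        using ab by (smt (verit) real_sqrt_ge_zero)
      have "a \<le> (of_rat q)\<^sup>2"
        using q(1) pos by (intro sqrt_le_D) simp
      moreover have "\<not> b \<le> (of_rat q)\<^sup>2"
        using q(2) pos real_le_lsqrt[of "of_rat q" b] by (auto dest: real_sqrt_le_mono)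
      ultimately show False
        using sep[of q] pos by simp
    qed
    from this[of "k x" "k (\<phi> x)"] this[of "k (\<phi> x)" "k x"] iff show "k x = k (\<phi> x)"
      by (meson k_nonneg linorder_neqE_linordered_idom)
  qed
qed

text \<open>The existential in \<open>quasinormal\<close> is met by explicit witnesses:
  multiplication by \<open>sqrt (k x)\<close> as modulus and \<open>mult_spectral\<close> as its
  spectral measure.\<close>

lemma AE_k_imp_quasinormal:
  assumes eq: "AE x in M. k x = k (\<phi> x)"
  shows "quasinormal (L2 M) (comp_op M \<phi>)"
proof -
  define r where "r x = sqrt (k x)" for x
  have r [measurable]: "r \<in> borel_measurable M" and r_nonneg: "\<And>x. 0 \<le> r x"
    by (simp_all add: r_def[abs_def])
  have "(\<lambda>x. (r x)\<^sup>2) = k"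
    by (simp add: r_def)
  then have mod: "is_modulus (L2 M) (comp_op M \<phi>) (mult_op M r)"
    using positive_selfadjoint_mult_op[OF r r_nonneg] mult_op_O_mult_op[OF r] comp_op_O_adjoint
    by (simp add: is_modulus_def)
  have "comp_op M \<phi> O graph_on (L2 M) (mult_spectral M r \<Delta>) \<subseteq> graph_on (L2 M) (mult_spectral M r \<Delta>) O comp_op M \<phi>"
    if D: "\<Delta> \<in> sets borel_nonneg" for \<Delta>
  proof clarify
    fix F G K assume FG: "(F, G) \<in> comp_op M \<phi>" and GK: "(G, K) \<in> graph_on (L2 M) (mult_spectral M r \<Delta>)"
    obtain f where f: "f \<in> sq_integrable M" "f \<circ> \<phi> \<in> sq_integrable M" "F = ae_class M f" "G = ae_class M (f \<circ> \<phi>)"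
      by (rule comp_opE[OF FG])
    define u where "u x = indicator \<Delta> (r x) * f x" for x
    define v where "v x = indicator \<Delta> (r x) * (f \<circ> \<phi>) x" for x
    have u: "u \<in> sq_integrable M" and v: "v \<in> sq_integrable M"
      unfolding u_def v_def by (rule sq_integrable_mult_spectral[OF r r_nonneg _ D], fact f)+
    have K: "K = ae_class M v"
      using GK f by (auto simp: graph_on_def v_def[abs_def] mult_spectral_class[OF r r_nonneg])
    \<comment> \<open>The invariance of \<open>k\<close> enters here: it gives
      \<open>r x = r (\<phi> x)\<close>, so both orders of projecting and composing multiply
      \<open>f \<circ> \<phi>\<close> by the same indicator.\<close>
    have "AE x in M. v x = u (\<phi> x)"
      using eq by eventually_elim (simp add: u_def v_def r_def)
    then have "(ae_class M u, K) \<in> comp_op M \<phi>"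
      using u v by (simp add: K comp_op_iff)
    moreover have "(F, ae_class M u) \<in> graph_on (L2 M) (mult_spectral M r \<Delta>)"
      using f by (auto simp: graph_on_def u_def[abs_def] mult_spectral_class[OF r r_nonneg])
    ultimately show "(F, K) \<in> graph_on (L2 M) (mult_spectral M r \<Delta>) O comp_op M \<phi>"
      by blast
  qed
  then show ?thesis
    unfolding quasinormal_def
    using linear_op_comp_op closed_op_comp_op dense mod is_spectral_measure_of_mult_spectral[OF r r_nonneg] by blast
qed

end

theorem proposition8p1:
  fixes M :: "'a measure" and \<phi> :: "'a \<Rightarrow> 'a"
  assumes "sigma_finite_measure M"
    and "nonsingular M \<phi>"
    and "densely_defined (L2 M) (comp_op M \<phi>)"
  shows "quasinormal (L2 M) (comp_op M \<phi>) \<longleftrightarrow>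
         (AE x in M. h_deriv M \<phi> x = h_deriv M \<phi> (\<phi> x))"
proof -
  interpret composition_operator M \<phi>
    using assms by (intro composition_operator.intro composition_operator_axioms.intro)
  show ?thesis
    using AE_h_iff_k quasinormal_imp_AE_k AE_k_imp_quasinormal by blast
qed

end
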